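(* Let $\mu_1,\mu_2,\lambda_1,\lambda_2,c>0$. For $\pi=(\pi_1,\pi_2)\in[0,1]^2$ let $g(\pi)=(1-\pi_1)(1-\pi_2)$, $h(\pi)=c\bigl(1-(1-\pi_1)(1-\pi_2)\bigr)$, $$V(\pi)=\inf_\tau\mathbb E_\pi\left[g(\Pi_\tau)+\int_0^\tau h(\Pi_s)\,ds\right],$$ and let $\mathcal C=\{\pi\in[0,1]^2:V(\pi)<g(\pi)\}$ be the continuation region. Then there exists a non-increasing lower semi-continuous function $b:[0,1]\to[0,1]$ such that $$\mathcal C=\{\pi\in[0,1]^2:\pi_2<b(\pi_1)\}.$$
   Context: Set-up (two-dimensional quickest detection). For $\pi\in[0,1]^2$, under $\mathbb P_\pi$ (expectation $\mathbb E_\pi$): $Y^1,Y^2$ are continuous-time Markov chains on $\{0,1\}$, $Y^i$ having transition rate matrix $\begin{pmatrix}-\lambda_i&\lambda_i\\0&0\end{pmatrix}$ and $\mathbb P_\pi(Y^i_0=1)=\pi_i$; $W^1,W^2$ are standard Brownian motions; and $Y^1,Y^2,W^1,W^2$ are independent. One observes $X=(X^1,X^2)$ with $dX^i_t=\mu_iY^i_t\,dt+dW^i_t$, $X^i_0=0$, and $\mathcal F^X$ is the filtration generated by $X$. The posterior process $\Pi=(\Pi^1,\Pi^2)$ is $\Pi^i_t=\mathbb E_\pi[Y^i_t\mid\mathcal F^X_t]$ (continuous version); it satisfies $\Pi_0=\pi$ and $d\Pi^i_t=\lambda_i(1-\Pi^i_t)\,dt+\mu_i\Pi^i_t(1-\Pi^i_t)\,d\bar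 W^i_t$, where $\bar W^i_t=X^i_t-\mu_i\int_0^t\Pi^i_s\,ds$ and $(\bar W^1,\bar W^2)$ is a two-dimensional standard Brownian motion. The infimum in $V$ is over ($\mathbb P_\pi$-a.s. finite) $\mathcal F^X$-stopping times. *)

theory Defs
  imports "HOL-Probability.Probability"
begin

section \<open>Filtrations, Markov chains, Brownian motion\<close>

text \<open>
  Processes have real time, but only times \<open>t \<ge> 0\<close> matter.  The filtration is indexed by
  \<open>ennreal\<close> (i.e. by \<open>[0, \<infinity>]\<close>), so that stopping times may take the value \<open>\<infinity>\<close>; at index \<open>\<infinity>\<close> it
  is the sigma-algebra generated by the whole process.  It is not completed.
\<close>

definition natural_filtration ::
  "'a set \<Rightarrow> 'b measure \<Rightarrow> (real \<Rightarrow> 'a \<Rightarrow> 'b) \<Rightarrow> ennreal \<Rightarrow> 'a measure" where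
  "natural_filtration \<Omega> N X t =
     sigma \<Omega> {X s -` A \<inter> \<Omega> | s A. 0 \<le> s \<and> ennreal s \<le> t \<and> A \<in> sets N}"

primrec rate_power :: "'s set \<Rightarrow> ('s \<Rightarrow> 's \<Rightarrow> real) \<Rightarrow> nat \<Rightarrow> 's \<Rightarrow> 's \<Rightarrow> real" where
  "rate_power E Q 0 = (\<lambda>i j. if i = j then 1 else 0)"
| "rate_power E Q (Suc n) = (\<lambda>i j. \<Sum>k\<in>E. Q i k * rate_power E Q n k j)"

text \<open>The \<open>(i, j)\<close> entry of the matrix exponential \<open>exp (t Q)\<close>, for a finite state space \<open>E\<close>.\<close>

definition transition_prob :: "'s set \<Rightarrow> ('s \<Rightarrow> 's \<Rightarrow> real) \<Rightarrow> real \<Rightarrow> 's \<Rightarrow> 's \<Rightarrow> real" where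
  "transition_prob E Q t i j = (\<Sum>n. t ^ n / fact n * rate_power E Q n i j)"

text \<open>
  Right-continuous Markov chain with state space \<open>E\<close> and rate matrix \<open>Q\<close>.  The last clause is the
  Markov property \<open>P (Y (t + u) = j | Y t = i, Y s = a s for s \<in> T) = exp (u Q) i j\<close> for finitely
  many past times \<open>T\<close>, multiplied out to avoid conditioning on null events.
\<close>

definition markov_chain ::
  "'a measure \<Rightarrow> 's set \<Rightarrow> ('s \<Rightarrow> 's \<Rightarrow> real) \<Rightarrow> (real \<Rightarrow> 'a \<Rightarrow> 's) \<Rightarrow> bool" where
  "markov_chain M E Q Y \<longleftrightarrow>
     (\<forall>t\<ge>0. Y t \<in> M \<rightarrow>\<^sub>M count_space E) \<and>
     (\<forall>\<omega>\<in>space M. \<forall>t\<ge>0. \<forall>\<^sub>F s in at_right t. Y s \<omega> = Y t \<omega>) \<and>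
     (\<forall>T t u a. \<forall>i\<in>E. \<forall>j\<in>E. finite T \<and> T \<subseteq> {0..t} \<and> 0 \<le> t \<and> 0 \<le> u \<longrightarrow>
        measure M {\<omega> \<in> space M. (\<forall>s\<in>T. Y s \<omega> = a s) \<and> Y t \<omega> = i \<and> Y (t + u) \<omega> = j} =
        measure M {\<omega> \<in> space M. (\<forall>s\<in>T. Y s \<omega> = a s) \<and> Y t \<omega> = i} * transition_prob E Q u i j)"

definition brownian_motion :: "'a measure \<Rightarrow> (real \<Rightarrow> 'a \<Rightarrow> real) \<Rightarrow> bool" where
  "brownian_motion M W \<longleftrightarrow>
     (\<forall>t\<ge>0. W t \<in> borel_measurable M) \<and>
     (\<forall>\<omega>\<in>space M. W 0 \<omega> = 0 \<and> continuous_on {0..} (\<lambda>t. W t \<omega>)) \<and>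
     (\<forall>s t. 0 \<le> s \<and> s < t \<longrightarrow>
        distributed M lborel (\<lambda>\<omega>. W t \<omega> - W s \<omega>) (normal_density 0 (sqrt (t - s)))) \<and>
     (\<forall>(n::nat) t. 0 \<le> t 0 \<and> (\<forall>k<n. t k \<le> t (Suc k)) \<longrightarrow>
        prob_space.indep_vars M (\<lambda>_. borel) (\<lambda>k \<omega>. W (t (Suc k)) \<omega> - W (t k) \<omega>) {..<n})"

section \<open>The detection problem\<close>

text \<open>
  The coordinates are indexed by the two-element type \<open>2\<close>, whose elements are \<open>1\<close> and \<open>2\<close>
  (with \<open>2 = 0\<close>); \<open>cbox 0 1 :: (real^2) set\<close> is the unit square.
\<close>

definition rate_matrix :: "real \<Rightarrow> nat \<Rightarrow> nat \<Rightarrow> real" where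
  "rate_matrix l i j = (if i = 0 then (if j = 0 then - l else l) else 0)"

definition observation ::
  "real^2 \<Rightarrow> (2 \<Rightarrow> real \<Rightarrow> 'a \<Rightarrow> nat) \<Rightarrow> (2 \<Rightarrow> real \<Rightarrow> 'a \<Rightarrow> real) \<Rightarrow> real \<Rightarrow> 'a \<Rightarrow> real^2" where
  "observation \<mu> Y W t \<omega> = (\<chi> i. \<mu> $ i * (LBINT s:{0..t}. real (Y i s \<omega>)) + W i t \<omega>)"

text \<open>
  \<open>S\<close> carries only the measurable space on which all the measures \<open>P \<pi>\<close> live.  The processes
  \<open>Y\<close>, \<open>W\<close>, and hence the observation and its filtration, do not depend on \<open>\<pi>\<close>, whereas
  the posterior process \<open>Post \<pi>\<close> does.
\<close>

locale quickest_detection =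
  fixes S :: "'a measure"
    and P :: "real^2 \<Rightarrow> 'a measure"
    and \<mu> l :: "real^2"
    and Y :: "2 \<Rightarrow> real \<Rightarrow> 'a \<Rightarrow> nat"
    and W :: "2 \<Rightarrow> real \<Rightarrow> 'a \<Rightarrow> real"
    and Post :: "real^2 \<Rightarrow> real \<Rightarrow> 'a \<Rightarrow> real^2"
  assumes sets_P: "\<pi> \<in> cbox 0 1 \<Longrightarrow> sets (P \<pi>) = sets S"
    and prob_space_P: "\<pi> \<in> cbox 0 1 \<Longrightarrow> prob_space (P \<pi>)"
    and markov_chain_Y: "\<pi> \<in> cbox 0 1 \<Longrightarrow> markov_chain (P \<pi>) {0, 1} (rate_matrix (l $ i)) (Y i)"
    and initial_Y: "\<pi> \<in> cbox 0 1 \<Longrightarrow> measure (P \<pi>) {\<omega> \<in> space (P \<pi>). Y i 0 \<omega> = 1} = \<pi> $ i"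
    and brownian_motion_W: "\<pi> \<in> cbox 0 1 \<Longrightarrow> brownian_motion (P \<pi>) (W i)"
    and indep_Y_W: "\<pi> \<in> cbox 0 1 \<Longrightarrow> prob_space.indep_sets (P \<pi>)
          (case_sum
             (\<lambda>i::2. sets (natural_filtration (space S) (count_space UNIV) (Y i) \<infinity>))
             (\<lambda>i::2. sets (natural_filtration (space S) borel (W i) \<infinity>)))
          UNIV"
    and measurable_Post: "\<pi> \<in> cbox 0 1 \<Longrightarrow> 0 \<le> t \<Longrightarrow> Post \<pi> t \<in> borel_measurable (P \<pi>)"
    and posterior_Post: "\<pi> \<in> cbox 0 1 \<Longrightarrow> 0 \<le> t \<Longrightarrow>
          AE \<omega> in P \<pi>. Post \<pi> t \<omega> $ i =
            real_cond_exp (P \<pi>) (natural_filtration (space S) borel (observation \<mu> Y W) t)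
              (\<lambda>\<omega>. real (Y i t \<omega>)) \<omega>"
    and continuous_Post: "\<pi> \<in> cbox 0 1 \<Longrightarrow> \<omega> \<in> space (P \<pi>) \<Longrightarrow>
          continuous_on {0..} (\<lambda>t. Post \<pi> t \<omega>)"

definition stop_cost :: "real^2 \<Rightarrow> real" where
  "stop_cost \<pi> = (1 - \<pi> $ 1) * (1 - \<pi> $ 2)"

definition running_cost :: "real \<Rightarrow> real^2 \<Rightarrow> real" where
  "running_cost c \<pi> = c * (1 - (1 - \<pi> $ 1) * (1 - \<pi> $ 2))"

text \<open>
  The costs are nonnegative on the unit square, so the expectation is taken in \<open>[0, \<infinity>]\<close>; a
  stopping time of infinite expected cost contributes \<open>\<infinity>\<close> to the infimum.
\<close>

definition expected_cost ::
  "'a measure \<Rightarrow> real \<Rightarrow> (real \<Rightarrow> 'a \<Rightarrow> real^2) \<Rightarrow> ('a \<Rightarrow> ennreal) \<Rightarrow> ennreal" where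
  "expected_cost M c Pr \<tau> =
     (\<integral>\<^sup>+\<omega>. (ennreal (stop_cost (Pr (enn2real (\<tau> \<omega>)) \<omega>)) +
            (\<integral>\<^sup>+s\<in>{s. 0 \<le> s \<and> ennreal s \<le> \<tau> \<omega>}. ennreal (running_cost c (Pr s \<omega>)) \<partial>lborel)) \<partial>M)"

definition optimal_value ::
  "'a measure \<Rightarrow> (ennreal \<Rightarrow> 'a measure) \<Rightarrow> real \<Rightarrow> (real \<Rightarrow> 'a \<Rightarrow> real^2) \<Rightarrow> ennreal" where
  "optimal_value M F c Pr =
     (INF \<tau>\<in>{\<tau>. stopping_time F \<tau> \<and> (AE \<omega> in M. \<tau> \<omega> < \<infinity>)}. expected_cost M c Pr \<tau>)"

definition lower_semicontinuous_on :: "'a::topological_space set \<Rightarrow> ('a \<Rightarrow> real) \<Rightarrow> bool" where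
  "lower_semicontinuous_on A f \<longleftrightarrow> (\<forall>x\<in>A. \<forall>y<f x. \<forall>\<^sub>F z in at x within A. y < f z)"

end

theory Submission
  imports Defs
begin

text \<open>
  Given the observations the two chains are conditionally independent, so the posterior
  probability that no change has occurred is \<open>stop_cost (Post \<pi> t)\<close>.  Hence the expected cost of
  a bounded stopping time is the expectation of a functional of the paths of \<open>Y\<close> and \<open>W\<close> that does
  not involve \<open>\<pi>\<close>.  On the sigma-algebra of these paths \<open>P \<pi>\<close> is affine in each coordinate of \<open>\<pi>\<close>,
  so the cost of stopping later minus the cost of stopping at once is a biaffine function \<open>D\<close> of
  \<open>\<pi>\<close>, nonnegative on the two edges where stopping is free.  A function that is affine in each
  variable with these properties can only be negative on an open down-set.  The continuation region
  is the union of the sets \<open>D < 0\<close> over all bounded stopping times, because truncating a stopping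
  time at a late time hardly increases its cost; so it is an open down-set too.
\<close>

section \<open>Open down-sets of the square\<close>

text \<open>The obstacle is that the prior enters twice: through the measure \<open>P \<pi>\<close>
  and through the process \<open>Post \<pi>\<close>. The observation filtration does not depend on
  it, so one stopping time can be tried under every prior; once the posterior is replaced by the
  chains themselves, only the measure varies. That replacement is an identity between integrals over
  events of the filtration at a fixed time; reaching a random time takes right-continuity and a
  discretisation from the right. It is done for stopping times bounded everywhere, since finiteness
  is given only almost surely and only under the one prior considered; truncation closes this gap.
  The law is affine in one coordinate at a time because it is a product over the coordinates;
  varying both produces the term \<open>x * y\<close>. The cost \<open>(1 - x) * (1 - y)\<close> of
  stopping at once has the same shape, so the difference stays in this class. Openness is expressed
  by \<open>up\<close>: each point of the set lies strictly below another one in both coordinates.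
  Together with the down-set property this yields both the strict inequality in the description of
  the set and lower semicontinuity.\<close>

lemma down_set_is_subgraph:
  fixes C :: "(real^2) set"
  assumes sub: "C \<subseteq> cbox 0 1"
    and down: "\<And>p q. p \<in> C \<Longrightarrow> q \<in> cbox 0 1 \<Longrightarrow> (\<And>i. q $ i \<le> p $ i) \<Longrightarrow> q \<in> C"
    and up: "\<And>p. p \<in> C \<Longrightarrow> \<exists>q\<in>C. \<forall>i. p $ i < q $ i"
  shows "\<exists>b :: real \<Rightarrow> real. b ` {0..1} \<subseteq> {0..1} \<and> antimono_on {0..1} b \<and>
           lower_semicontinuous_on {0..1} b \<and> C = {p \<in> cbox 0 1. p $ 2 < b (p $ 1)}"
proof -
  define v :: "real \<Rightarrow> real \<Rightarrow> real^2" where "v x y = vector [x, y]" for x y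
  have v [simp]: "v x y $ 1 = x" "v x y $ 2 = y" for x y
    by (simp_all add: v_def)
  have v_eta: "v (p $ 1) (p $ 2) = p" for p
    by (simp add: vec_eq_iff forall_2)
  have box: "v x y \<in> cbox 0 1 \<longleftrightarrow> 0 \<le> x \<and> x \<le> 1 \<and> 0 \<le> y \<and> y \<le> 1" for x y
    by (auto simp: mem_box_cart forall_2)
  have bounds: "0 \<le> x \<and> x \<le> 1 \<and> 0 \<le> y \<and> y \<le> 1" if "v x y \<in> C" for x y
    using that sub box by blast
  have down': "v x' y' \<in> C" if "v x y \<in> C" "0 \<le> x'" "x' \<le> x" "0 \<le> y'" "y' \<le> y" for x y x' y'
  proof (rule down[OF that(1)])
    show "v x' y' \<in> cbox 0 1" using that bounds[OF that(1)] by (auto simp: box)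
    have "\<forall>i. v x' y' $ i \<le> v x y $ i" using that by (simp add: forall_2)
    then show "v x' y' $ i \<le> v x y $ i" for i by blast
  qed
  have up': "\<exists>x' y'. v x' y' \<in> C \<and> x < x' \<and> y < y'" if C: "v x y \<in> C" for x y
  proof -
    obtain q where q: "q \<in> C" "\<forall>i. v x y $ i < q $ i"
      using up[OF C] by blast
    then have "v (q $ 1) (q $ 2) \<in> C" "x < q $ 1" "y < q $ 2"
      using v_eta[of q] spec[OF q(2), of 1] spec[OF q(2), of 2] by simp_all
    then show ?thesis by blast
  qed
  \<comment> \<open>The inserted 0 gives an empty section the supremum 0, so that no
    \<open>y\<close> \<ge> 0 lies below \<open>b x\<close> there.\<close>
  define H where "H x = insert 0 {y. v x y \<in> C}" for x
  define b where "b x = Sup (H x)" for x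
  have bdd: "bdd_above (H x)" for x
    by (rule bdd_aboveI[of _ 1]) (use bounds in \<open>auto simp: H_def\<close>)
  have b_ge: "y \<le> b x" if "v x y \<in> C" for x y
    unfolding b_def by (rule cSup_upper[OF _ bdd]) (use that in \<open>auto simp: H_def\<close>)
  have b_nonneg: "0 \<le> b x" for x
    unfolding b_def by (rule cSup_upper[OF _ bdd]) (auto simp: H_def)
  have b_le1: "b x \<le> 1" for x
    unfolding b_def by (rule cSup_least) (use bounds in \<open>auto simp: H_def\<close>)
  have less_b: "v x y \<in> C" if "0 \<le> x" "0 \<le> y" "y < b x" for x y
  proof -
    have "\<exists>y'\<in>H x. y < y'"
      using that(3) less_cSup_iff[OF _ bdd, of x y] by (auto simp: b_def H_def)
    then obtain y' where y': "y' \<in> H x" "y < y'" by blast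
    then have "v x y' \<in> C" using that by (auto simp: H_def)
    then show ?thesis by (rule down') (use that y' in auto)
  qed
  \<comment> \<open>The supremum of a section is never attained inside \<open>C\<close>:
    \<open>up'\<close> supplies a point further up and to the right, and moving it back left to
    \<open>x\<close> keeps its larger height.\<close>
  have b_greater: "y < b x" if C: "v x y \<in> C" for x y
  proof -
    obtain x' y' where C': "v x' y' \<in> C" and less: "x < x'" "y < y'"
      using up'[OF C] by blast
    have "v x y' \<in> C"
      by (rule down'[OF C']) (use bounds[OF C] bounds[OF C'] less in auto)
    then show ?thesis using b_ge[of x y'] less by linarith
  qed
  show ?thesis
  proof (intro exI[of _ b] conjI)
    show "b ` {0..1} \<subseteq> {0..1}"
      using b_nonneg b_le1 by auto
    show "antimono_on {0..1} b"
    proof (rule monotone_onI)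
      fix x y :: real assume xy: "x \<in> {0..1}" "y \<in> {0..1}" "x \<le> y"
      show "b y \<le> b x"
        unfolding b_def[of y]
      proof (rule cSup_least)
        fix z assume "z \<in> H y"
        then consider "z = 0" | "v y z \<in> C" by (auto simp: H_def)
        then show "z \<le> b x"
        proof cases
          case 2
          have "v x z \<in> C" by (rule down'[OF 2]) (use bounds[OF 2] xy in auto)
          then show ?thesis by (rule b_ge)
        qed (use b_nonneg in auto)
      qed (simp add: H_def)
    qed
    show "lower_semicontinuous_on {0..1} b"
      unfolding lower_semicontinuous_on_def
    proof (intro ballI allI impI)
      fix x y assume x: "x \<in> {0..1}" and y: "y < b x"
      show "\<forall>\<^sub>F z in at x within {0..1}. y < b z"
      proof (cases "y < 0")
        case True
        then show ?thesis using b_nonneg by (auto intro!: always_eventually intro: less_le_trans)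
      next
        case False
        then have "v x y \<in> C" using less_b x y by auto
        then obtain x' y' where C': "v x' y' \<in> C" and less: "x < x'" "y < y'"
          using up' by blast
        \<comment> \<open>The point \<open>v x' y'\<close> moves left to \<open>v z y'\<close> for
          every \<open>z\<close> below \<open>x'\<close>, and these \<open>z\<close> fill a whole
          neighbourhood of \<open>x\<close> because \<open>x < x'\<close>.\<close>
        have "y < b z" if "0 \<le> z" "z < x'" for z
        proof -
          have "v z y' \<in> C" by (rule down'[OF C']) (use that bounds[OF C'] in auto)
          then show ?thesis using b_ge[of z y'] less by linarith
        qed
        moreover have "\<forall>\<^sub>F z in at x within {0..1}. z < x'"
          using less(1) by (intro order_tendstoD(2)[OF tendsto_ident_at])
        moreover have "\<forall>\<^sub>F z in at x within {0..1}. z \<in> {0..1}"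
          by (simp add: eventually_at_filter)
        ultimately show ?thesis by (auto elim: eventually_elim2)
      qed
    qed
    show "C = {p \<in> cbox 0 1. p $ 2 < b (p $ 1)}"
    proof (intro set_eqI iffI CollectI conjI)
      fix p assume p: "p \<in> C"
      then show "p \<in> cbox 0 1" using sub by blast
      show "p $ 2 < b (p $ 1)" using b_greater[of "p $ 1" "p $ 2"] p by (simp add: v_eta)
    next
      fix p :: "real^2" assume "p \<in> {p \<in> cbox 0 1. p $ 2 < b (p $ 1)}"
      then show "p \<in> C"
        using less_b[of "p $ 1" "p $ 2"] by (auto simp: v_eta mem_box_cart forall_2)
    qed
  qed
qed

text \<open>An affine function of one variable that is nonnegative at 1 and negative at some
  \<open>s\<close> \<le> 1 has positive slope, so it stays negative to the left of \<open>s\<close>.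
  This is applied to the first variable along the line through the given point, and then to the
  second one along the line at \<open>x'\<close>.\<close>

lemma biaffine_negative_down:
  fixes a b c d x y x' y' :: real
  defines "D \<equiv> \<lambda>x y. a + b * x + c * y + d * (x * y)"
  assumes edge1: "\<And>y. 0 \<le> y \<Longrightarrow> y \<le> 1 \<Longrightarrow> 0 \<le> D 1 y"
    and edge2: "\<And>x. 0 \<le> x \<Longrightarrow> x \<le> 1 \<Longrightarrow> 0 \<le> D x 1"
    and neg: "D x y < 0"
    and xy: "0 \<le> x'" "x' \<le> x" "x \<le> 1" "0 \<le> y'" "y' \<le> y" "y \<le> 1"
  shows "D x' y' < 0"
proof -
  have affine_neg: "u + w * s' < 0"
    if "u + w * s < 0" "0 \<le> u + w * 1" "s' \<le> s" "s \<le> 1" for u w s s' :: real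
  proof -
    have "0 < w * (1 - s)" using that(1,2) by (simp add: algebra_simps)
    then have "0 < w" using that(4) by (simp add: zero_less_mult_iff)
    then have "w * s' \<le> w * s" using that(3) by (simp add: mult_left_mono)
    then show ?thesis using that(1) by simp
  qed
  have yx: "0 \<le> y" "y \<le> 1" "0 \<le> x'" "x' \<le> 1" using xy by linarith+
  have "(a + c * y) + (b + d * y) * x < 0" "0 \<le> (a + c * y) + (b + d * y) * 1"
    using neg edge1[OF yx(1,2)] unfolding D_def by (simp_all add: algebra_simps)
  then have "(a + c * y) + (b + d * y) * x' < 0"
    using xy by (intro affine_neg[of _ _ x x'])
  \<comment> \<open>The same polynomial, regrouped as an affine function of the second variable with
    the first one frozen at \<open>x'\<close>; the other edge now controls the slope.\<close>
  moreover have "(a + c * y) + (b + d * y) * x' = (a + b * x') + (c + d * x') * y"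
    by (simp add: algebra_simps)
  moreover have "0 \<le> (a + b * x') + (c + d * x') * 1"
    using edge2[OF yx(3,4)] unfolding D_def by (simp add: algebra_simps)
  ultimately have "(a + b * x') + (c + d * x') * y' < 0"
    using xy by (intro affine_neg[of _ _ y y']) simp_all
  moreover have "(a + b * x') + (c + d * x') * y' = D x' y'"
    unfolding D_def by (simp add: algebra_simps)
  ultimately show ?thesis by simp
qed

text \<open>By continuity the polynomial remains negative on a short diagonal segment going up from
  the point; the strict bounds leave room for it inside the square.\<close>

lemma biaffine_negative_up:
  fixes a b c d x y :: real
  defines "D \<equiv> \<lambda>x y. a + b * x + c * y + d * (x * y)"
  assumes "D x y < 0" "x < 1" "y < 1"
  obtains x' y' where "x < x'" "x' < 1" "y < y'" "y' < 1" "D x' y' < 0"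
proof -
  have "((\<lambda>h. D (x + h) (y + h)) \<longlongrightarrow> D (x + 0) (y + 0)) (at_right 0)"
    unfolding D_def by (intro tendsto_intros)
  then have "\<forall>\<^sub>F h in at_right 0. D (x + h) (y + h) < 0"
    using assms(2) by (intro order_tendstoD(2)) simp_all
  moreover have "\<forall>\<^sub>F h in at_right 0. h < min (1 - x) (1 - y)"
    using assms(3,4) by (intro order_tendstoD(2)[OF tendsto_ident_at]) simp
  moreover have "\<forall>\<^sub>F h :: real in at_right 0. 0 < h"
    by (simp add: eventually_at_filter)
  ultimately have "\<forall>\<^sub>F h in at_right 0. D (x + h) (y + h) < 0 \<and> h < min (1 - x) (1 - y) \<and> 0 < h"
    by (intro eventually_conj)
  then obtain h where "D (x + h) (y + h) < 0" "h < min (1 - x) (1 - y)" "0 < h"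
    using eventually_happens'[OF trivial_limit_at_right_real] by blast
  then show ?thesis by (intro that[of "x + h" "y + h"]) simp_all
qed

section \<open>Right-continuous processes\<close>

text \<open>The \<open>+ 1\<close> after the ceiling puts the grid point strictly to the right of
  \<open>x\<close> even when \<open>x\<close> lies on the grid. This matters because a limit along
  \<open>at_right x\<close> says nothing about a sequence that hits \<open>x\<close>.\<close>

lemma grid_right_limit:
  fixes x :: real
  shows "((\<lambda>n. (real_of_int \<lceil>real (Suc n) * x\<rceil> + 1) / real (Suc n)) \<longlongrightarrow> x) sequentially"
    and "x < (real_of_int \<lceil>real (Suc n) * x\<rceil> + 1) / real (Suc n)"
proof -
  have lower: "x < (real_of_int \<lceil>real (Suc n) * x\<rceil> + 1) / real (Suc n)" for n
  proof -
    have "real (Suc n) * x < real_of_int \<lceil>real (Suc n) * x\<rceil> + 1" by linarith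
    then show ?thesis by (simp add: pos_less_divide_eq mult.commute del: of_nat_Suc)
  qed
  have upper: "(real_of_int \<lceil>real (Suc n) * x\<rceil> + 1) / real (Suc n) \<le> x + 2 * (1 / real (Suc n))" for n
  proof -
    have "real_of_int \<lceil>real (Suc n) * x\<rceil> + 1 \<le> real (Suc n) * x + 2" by linarith
    then show ?thesis
      by (simp add: pos_divide_le_eq distrib_right del: of_nat_Suc) (simp add: mult.commute)
  qed
  show "x < (real_of_int \<lceil>real (Suc n) * x\<rceil> + 1) / real (Suc n)" by (rule lower)
  have "(\<lambda>n. x + 2 * (1 / real (Suc n))) \<longlonglongrightarrow> x + 2 * 0"
    by (intro tendsto_intros lim_1_over_n LIMSEQ_Suc)
  then have lim: "(\<lambda>n. x + 2 * (1 / real (Suc n))) \<longlonglongrightarrow> x" by simp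
  show "((\<lambda>n. (real_of_int \<lceil>real (Suc n) * x\<rceil> + 1) / real (Suc n)) \<longlongrightarrow> x) sequentially"
    by (rule tendsto_sandwich[OF _ _ tendsto_const lim])
      (intro always_eventually allI less_imp_le[OF lower] upper)+
qed

lemma right_continuous_grid_limit:
  fixes f :: "real \<Rightarrow> real"
  assumes "(f \<longlongrightarrow> f x) (at_right x)"
  shows "(\<lambda>n. f ((real_of_int \<lceil>real (Suc n) * x\<rceil> + 1) / real (Suc n))) \<longlonglongrightarrow> f x"
proof (rule filterlim_compose[OF assms])
  show "filterlim (\<lambda>n. (real_of_int \<lceil>real (Suc n) * x\<rceil> + 1) / real (Suc n)) (at_right x) sequentially"
    unfolding filterlim_at
    using grid_right_limit[of x] by (auto intro!: always_eventually less_imp_neq[symmetric] simp del: of_nat_Suc)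
qed

text \<open>Evaluated at the grid time to the right, the process depends on \<open>t\<close> only
  through an integer, and a countable choice among measurable functions is measurable.
  Right-continuity makes \<open>f\<close> the pointwise limit.\<close>

lemma right_continuous_jointly_measurable:
  fixes f :: "real \<Rightarrow> 'a \<Rightarrow> real"
  assumes f: "\<And>t. 0 \<le> t \<Longrightarrow> f t \<in> borel_measurable M"
    and right: "\<And>t \<omega>. 0 \<le> t \<Longrightarrow> \<omega> \<in> space M \<Longrightarrow> ((\<lambda>s. f s \<omega>) \<longlongrightarrow> f t \<omega>) (at_right t)"
  shows "(\<lambda>(t, \<omega>). f (max 0 t) \<omega>) \<in> borel_measurable (borel \<Otimes>\<^sub>M M)"
proof (rule borel_measurable_LIMSEQ_real)
  \<comment> \<open>The outer \<open>max 0\<close> makes the grid time nonnegative for every integer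
    \<open>k\<close>, including those never attained, so that \<open>f (?t n k)\<close> is
    measurable for all of them.\<close>
  let ?t = "\<lambda>n k. max 0 ((real_of_int k + 1) / real (Suc n))"
  let ?k = "\<lambda>n z. \<lceil>real (Suc n) * max 0 (fst z)\<rceil>"
  have grid: "?t n (?k n z) = (real_of_int (?k n z) + 1) / real (Suc n)" for n and z :: "real \<times> 'a"
    using grid_right_limit(2)[of "max 0 (fst z)" n] by simp
  show "(\<lambda>n. f (?t n (?k n z)) (snd z)) \<longlonglongrightarrow> (\<lambda>(t, \<omega>). f (max 0 t) \<omega>) z"
    if "z \<in> space (borel \<Otimes>\<^sub>M M)" for z
    unfolding split_beta grid
    by (rule right_continuous_grid_limit[of "\<lambda>t. f t (snd z)"], rule right)
      (use that in \<open>auto simp: space_pair_measure\<close>)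
  show "(\<lambda>z. f (?t n (?k n z)) (snd z)) \<in> borel_measurable (borel \<Otimes>\<^sub>M M)" for n
  proof (rule measurable_compose_countable[where f="\<lambda>k z. f (?t n k) (snd z)"])
    show "?k n \<in> borel \<Otimes>\<^sub>M M \<rightarrow>\<^sub>M count_space UNIV"
      by measurable
    show "(\<lambda>z. f (?t n k) (snd z)) \<in> borel_measurable (borel \<Otimes>\<^sub>M M)" for k
      by (rule measurable_compose[OF measurable_snd f]) simp
  qed
qed

lemma right_continuous_random_time_measurable:
  fixes f :: "real \<Rightarrow> 'a \<Rightarrow> real"
  assumes f: "\<And>t. 0 \<le> t \<Longrightarrow> f t \<in> borel_measurable M"
    and right: "\<And>t \<omega>. 0 \<le> t \<Longrightarrow> \<omega> \<in> space M \<Longrightarrow> ((\<lambda>s. f s \<omega>) \<longlongrightarrow> f t \<omega>) (at_right t)"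
    and \<sigma>: "\<sigma> \<in> borel_measurable M" "\<And>\<omega>. \<omega> \<in> space M \<Longrightarrow> 0 \<le> \<sigma> \<omega>"
  shows "(\<lambda>\<omega>. f (\<sigma> \<omega>) \<omega>) \<in> borel_measurable M"
proof -
  have "(\<lambda>\<omega>. (\<lambda>(t, \<omega>). f (max 0 t) \<omega>) (\<sigma> \<omega>, \<omega>)) \<in> borel_measurable M"
    by (rule measurable_compose[OF _ right_continuous_jointly_measurable[OF f right]]) (use \<sigma> in auto)
  then show ?thesis
    by (rule measurable_cong[THEN iffD1, rotated]) (use \<sigma>(2) in \<open>auto simp: max_def\<close>)
qed

section \<open>Extension from a generating pi-system\<close>

text \<open>Dynkin's argument: the condition \<open>p + q = 1\<close> is what carries the identity
  over to complements. The weights are arbitrary reals, so \<open>p = 1\<close>,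
  \<open>q = 0\<close> gives uniqueness of a probability measure as a special case.\<close>

lemma measure_mixture_sigma_sets:
  fixes p q :: real
  assumes M: "prob_space M" "space M = \<Omega>" "sigma_sets \<Omega> G \<subseteq> sets M"
    and M0: "prob_space M0" "space M0 = \<Omega>" "sigma_sets \<Omega> G \<subseteq> sets M0"
    and M1: "prob_space M1" "space M1 = \<Omega>" "sigma_sets \<Omega> G \<subseteq> sets M1"
    and G: "Int_stable G" "G \<subseteq> Pow \<Omega>"
    and pq: "p + q = 1"
    and eq: "\<And>A. A \<in> G \<Longrightarrow> measure M A = p * measure M0 A + q * measure M1 A"
    and A: "A \<in> sigma_sets \<Omega> G"
  shows "measure M A = p * measure M0 A + q * measure M1 A"
  using G A
proof (induction rule: sigma_sets_induct_disjoint)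
  case (compl A)
  have compl_eq: "measure N (\<Omega> - A) = 1 - measure N A"
    if "prob_space N" "space N = \<Omega>" "sigma_sets \<Omega> G \<subseteq> sets N" for N
    using prob_space.prob_compl[OF that(1), of A] that compl by auto
  show ?case
    unfolding compl_eq[OF M] compl_eq[OF M0] compl_eq[OF M1] compl(2)
    using pq by (simp add: algebra_simps flip: distrib_left)
next
  case (union A)
  have "(\<lambda>i. measure N (A i)) sums measure N (\<Union>i. A i)"
    if "prob_space N" "sigma_sets \<Omega> G \<subseteq> sets N" for N
    using that union by (intro finite_measure.finite_measure_UNION) (auto dest: prob_space.finite_measure)
  note sums = this[OF M(1,3)] this[OF M0(1,3)] this[OF M1(1,3)]
  have "(\<lambda>i. p * measure M0 (A i) + q * measure M1 (A i)) sums
      (p * measure M0 (\<Union>i. A i) + q * measure M1 (\<Union>i. A i))"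
    by (intro sums_add sums_mult sums)
  then show ?case
    using sums(1) union(3) by (simp add: sums_unique2)
qed (use eq in auto)

text \<open>Dynkin's argument for the signed measure with density \<open>f\<close>. The total
  integral is a separate hypothesis because the whole space need not belong to \<open>G\<close>; it
  serves the complement step.\<close>

lemma set_integral_eq_0_sigma_sets:
  fixes f :: "'a \<Rightarrow> real"
  assumes f: "integrable M f"
    and G: "Int_stable G" "G \<subseteq> sets M"
    and zero: "\<And>A. A \<in> G \<Longrightarrow> (LINT x:A|M. f x) = 0" "(LINT x|M. f x) = 0"
    and A: "A \<in> sigma_sets (space M) G"
  shows "(LINT x:A|M. f x) = 0"
proof -
  have sets: "B \<in> sets M" if "B \<in> sigma_sets (space M) G" for B
    using that sets.sigma_sets_subset[OF G(2)] by blast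
  have int: "set_integrable M B f" if "B \<in> sigma_sets (space M) G" for B
    unfolding set_integrable_def using sets[OF that] f by (rule integrable_mult_indicator)
  have "G \<subseteq> Pow (space M)" using G(2) sets.space_closed by blast
  with G(1) show ?thesis
    using A
  proof (induction rule: sigma_sets_induct_disjoint)
    case (compl A)
    have "(LINT x:space M|M. f x) = (LINT x:A \<union> (space M - A)|M. f x)"
      using sets.sets_into_space[OF sets[OF compl(1)]] by (simp add: Un_absorb1)
    also have "\<dots> = (LINT x:A|M. f x) + (LINT x:space M - A|M. f x)"
      by (rule set_integral_Un) (use int compl(1) sigma_sets.Compl[OF compl(1)] in auto)
    finally show ?case
      using compl(2) zero(2) set_integral_space[OF f] by simp
  next
    case (union A)
    have A: "A i \<in> sigma_sets (space M) G" for i using union(2) by auto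
    have "(LINT x:(\<Union>i. A i)|M. f x) = (\<Sum>i. LINT x:A i|M. f x)"
      using union(1) A sets[OF A] by (intro lebesgue_integral_countable_add int)
        (auto simp: disjoint_family_on_def intro!: sigma_sets.Union)
    then show ?case using union(3) by simp
  qed (use zero in \<open>auto simp: set_lebesgue_integral_def\<close>)
qed

text \<open>The measures are compared on the sub-sigma-algebra \<open>F\<close> alone, so the
  induction runs over \<open>F\<close>-measurable integrands while the integrals are taken over the
  larger spaces.\<close>

lemma nn_integral_mixture:
  fixes q :: real
  assumes M: "prob_space M" "subalgebra M F" and M0: "prob_space M0" "subalgebra M0 F"
    and M1: "prob_space M1" "subalgebra M1 F" and q: "0 \<le> q" "q \<le> 1"
    and eq: "\<And>A. A \<in> sets F \<Longrightarrow> measure M A = (1 - q) * measure M0 A + q * measure M1 A"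
    and f: "f \<in> borel_measurable F"
  shows "(\<integral>\<^sup>+x. f x \<partial>M) = ennreal (1 - q) * (\<integral>\<^sup>+x. f x \<partial>M0) + ennreal q * (\<integral>\<^sup>+x. f x \<partial>M1)"
proof -
  have sub: "space N = space F" "\<And>A. A \<in> sets F \<Longrightarrow> A \<in> sets N"
    "\<And>g. g \<in> borel_measurable F \<Longrightarrow> (g :: 'a \<Rightarrow> ennreal) \<in> borel_measurable N" if "subalgebra N F" for N
    using that measurable_from_subalg[OF that] by (auto simp: subalgebra_def)
  show ?thesis
    using f
  proof (induction rule: borel_measurable_induct)
    case (cong g h)
    have "(\<integral>\<^sup>+x. g x \<partial>N) = (\<integral>\<^sup>+x. h x \<partial>N)" if "subalgebra N F" for N
      by (rule nn_integral_cong) (use cong(3) sub(1)[OF that] in simp)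
    then show ?case using cong(4) M(2) M0(2) M1(2) by simp
  next
    case (set A)
    have "ennreal (measure M A) = ennreal (1 - q) * ennreal (measure M0 A) + ennreal q * ennreal (measure M1 A)"
      unfolding eq[OF set] using q by (simp add: ennreal_plus ennreal_mult)
    moreover have "(\<integral>\<^sup>+x. indicator A x \<partial>N) = ennreal (measure N A)"
      if "prob_space N" "subalgebra N F" for N
      unfolding nn_integral_indicator[OF sub(2)[OF that(2) set]]
      by (rule finite_measure.emeasure_eq_measure[OF prob_space.finite_measure[OF that(1)]])
    ultimately show ?case
      using M M0 M1 by simp
  next
    case (mult g a)
    have *: "(\<integral>\<^sup>+x. a * g x \<partial>N) = a * (\<integral>\<^sup>+x. g x \<partial>N)" if "subalgebra N F" for N
      by (rule nn_integral_cmult[OF sub(3)[OF that]]) fact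
    have IH: "(\<integral>\<^sup>+x. g x \<partial>M) = ennreal (1 - q) * (\<integral>\<^sup>+x. g x \<partial>M0) + ennreal q * (\<integral>\<^sup>+x. g x \<partial>M1)"
      by fact
    show ?case
      unfolding *[OF M(2)] *[OF M0(2)] *[OF M1(2)] IH by (simp only: distrib_left mult.left_commute)
  next
    case (add g h)
    have *: "(\<integral>\<^sup>+x. h x + g x \<partial>N) = (\<integral>\<^sup>+x. h x \<partial>N) + (\<integral>\<^sup>+x. g x \<partial>N)" if "subalgebra N F" for N
      by (rule nn_integral_add[OF sub(3)[OF that] sub(3)[OF that]]) fact+
    have IH: "(\<integral>\<^sup>+x. g x \<partial>M) = ennreal (1 - q) * (\<integral>\<^sup>+x. g x \<partial>M0) + ennreal q * (\<integral>\<^sup>+x. g x \<partial>M1)"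
      "(\<integral>\<^sup>+x. h x \<partial>M) = ennreal (1 - q) * (\<integral>\<^sup>+x. h x \<partial>M0) + ennreal q * (\<integral>\<^sup>+x. h x \<partial>M1)"
      by fact+
    show ?case
      unfolding *[OF M(2)] *[OF M0(2)] *[OF M1(2)] IH by (simp only: distrib_left ac_simps)
  next
    case (seq U)
    have SUP: "(\<integral>\<^sup>+x. (SUP i. U i) x \<partial>N) = (SUP i. \<integral>\<^sup>+x. U i x \<partial>N)" if "subalgebra N F" for N
      unfolding SUP_apply
      by (rule nn_integral_monotone_convergence_SUP[OF _ sub(3)[OF that]]) fact+
    have inc: "incseq (\<lambda>i. ennreal a * (\<integral>\<^sup>+x. U i x \<partial>N))" for a N
      using \<open>incseq U\<close> unfolding incseq_def le_fun_def
      by (intro allI impI mult_left_mono nn_integral_mono) auto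
    have IH: "(\<integral>\<^sup>+x. U i x \<partial>M) = ennreal (1 - q) * (\<integral>\<^sup>+x. U i x \<partial>M0) + ennreal q * (\<integral>\<^sup>+x. U i x \<partial>M1)" for i
      by fact
    have "(SUP i. \<integral>\<^sup>+x. U i x \<partial>M) =
        (SUP i. ennreal (1 - q) * (\<integral>\<^sup>+x. U i x \<partial>M0) + ennreal q * (\<integral>\<^sup>+x. U i x \<partial>M1))"
      by (simp only: IH)
    also have "\<dots> = ennreal (1 - q) * (SUP i. \<integral>\<^sup>+x. U i x \<partial>M0) + ennreal q * (SUP i. \<integral>\<^sup>+x. U i x \<partial>M1)"
      by (simp only: ennreal_SUP_add[OF inc inc] SUP_mult_left_ennreal)
    finally show ?case by (simp only: SUP[OF M(2)] SUP[OF M0(2)] SUP[OF M1(2)])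
  qed
qed

lemma set_integral_diff_integrable:
  fixes f g :: "'a \<Rightarrow> real"
  assumes "A \<in> sets M" "integrable M f" "integrable M g"
  shows "(LINT x:A|M. f x - g x) = (LINT x:A|M. f x) - (LINT x:A|M. g x)"
  using integrable_mult_indicator[OF assms(1,2)] integrable_mult_indicator[OF assms(1,3)]
  by (intro set_integral_diff(2)) (simp_all add: set_integrable_def)

section \<open>Stopped costs\<close>

text \<open>Replace \<open>\<sigma>\<close> by the grid time just to its right. Since
  \<open>\<sigma>\<close> is bounded this takes finitely many values, and each level set is known at
  the corresponding time, so the integral is a finite sum of zeros; dominated convergence and
  right-continuity lead back to \<open>\<sigma>\<close>. The hypothesis \<open>stop\<close> is
  stated for all \<open>s\<close> \<le> \<open>t\<close>, which absorbs the monotonicity of the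
  filtration and allows negative \<open>s\<close>.\<close>

lemma stopped_integral_eq_0:
  fixes d :: "real \<Rightarrow> 'a \<Rightarrow> real" and \<sigma> :: "'a \<Rightarrow> real"
  assumes M: "prob_space M"
    and F: "\<And>t. 0 \<le> t \<Longrightarrow> subalgebra M (F t)"
    and d: "\<And>t. 0 \<le> t \<Longrightarrow> d t \<in> borel_measurable M"
    and bounded: "\<And>t \<omega>. 0 \<le> t \<Longrightarrow> \<omega> \<in> space M \<Longrightarrow> \<bar>d t \<omega>\<bar> \<le> K"
    and right: "\<And>t \<omega>. 0 \<le> t \<Longrightarrow> \<omega> \<in> space M \<Longrightarrow> ((\<lambda>s. d s \<omega>) \<longlongrightarrow> d t \<omega>) (at_right t)"
    and zero: "\<And>t A. 0 \<le> t \<Longrightarrow> A \<in> sets (F t) \<Longrightarrow> (LINT \<omega>:A|M. d t \<omega>) = 0"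
    and stop: "\<And>s t. 0 \<le> t \<Longrightarrow> s \<le> t \<Longrightarrow> {\<omega>\<in>space M. \<sigma> \<omega> \<le> s} \<in> sets (F t)"
    and \<sigma>: "\<sigma> \<in> borel_measurable M" "\<And>\<omega>. \<omega> \<in> space M \<Longrightarrow> 0 \<le> \<sigma> \<omega> \<and> \<sigma> \<omega> \<le> T"
  shows "(LINT \<omega>|M. d (\<sigma> \<omega>) \<omega>) = 0"
proof -
  interpret prob_space M by (rule M)
  define k where "k n \<omega> = \<lceil>real (Suc n) * \<sigma> \<omega>\<rceil>" for n \<omega>
  define t where "t n j = (real_of_int j + 1) / real (Suc n)" for n j
  have t_nonneg: "0 \<le> t n j" if "0 \<le> j" for n j
    using that by (simp add: t_def)
  have k_nonneg: "0 \<le> k n \<omega>" if "\<omega> \<in> space M" for n \<omega>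
    using \<sigma>(2)[OF that] by (simp add: k_def order.strict_trans2[of "-1" 0])
  have [measurable]: "(\<lambda>\<omega>. d (t n (k n \<omega>)) \<omega>) \<in> borel_measurable M" for n
    unfolding k_def t_def
    by (rule right_continuous_random_time_measurable[OF d right])
      (use \<sigma> k_nonneg in \<open>auto simp: k_def simp del: of_nat_Suc intro!: divide_nonneg_nonneg\<close>)
  have [measurable]: "(\<lambda>\<omega>. d (\<sigma> \<omega>) \<omega>) \<in> borel_measurable M"
    by (rule right_continuous_random_time_measurable[OF d right]) (use \<sigma> in auto)
  \<comment> \<open>The level set says that \<open>\<sigma>\<close> lies in the half-open cell
    ending at \<open>j / Suc n\<close>, one grid step before \<open>t n j\<close>. For
    \<open>j = 0\<close> the lower endpoint is negative.\<close>
  have level: "{\<omega>\<in>space M. k n \<omega> = j} \<in> sets (F (t n j))" if "0 \<le> j" for n j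
  proof -
    have "{\<omega>\<in>space M. k n \<omega> = j} =
        {\<omega>\<in>space M. \<sigma> \<omega> \<le> real_of_int j / real (Suc n)} -
        {\<omega>\<in>space M. \<sigma> \<omega> \<le> (real_of_int j - 1) / real (Suc n)}"
      by (auto simp: k_def ceiling_eq_iff pos_le_divide_eq pos_less_divide_eq mult.commute not_le
          simp del: of_nat_Suc)
    also have "\<dots> \<in> sets (F (t n j))"
      using that
      by (intro sets.Diff stop t_nonneg) (auto simp: t_def intro!: divide_right_mono simp del: of_nat_Suc)
    finally show ?thesis .
  qed
  have zero_n: "(LINT \<omega>|M. d (t n (k n \<omega>)) \<omega>) = 0" for n
  proof -
    let ?J = "{0..\<lceil>real (Suc n) * T\<rceil>}"
    let ?A = "\<lambda>j. {\<omega>\<in>space M. k n \<omega> = j}"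
    have A: "?A j \<in> sets M" if "j \<in> ?J" for j
      using level[of j n] F[OF t_nonneg, of j n] that by (auto simp: subalgebra_def)
    have "(LINT \<omega>|M. d (t n (k n \<omega>)) \<omega>) = (LINT \<omega>|M. (\<Sum>j\<in>?J. indicator (?A j) \<omega> * d (t n j) \<omega>))"
    proof (rule Bochner_Integration.integral_cong[OF refl])
      fix \<omega> assume \<omega>: "\<omega> \<in> space M"
      have "k n \<omega> \<in> ?J"
        using k_nonneg[OF \<omega>] \<sigma>(2)[OF \<omega>] by (auto simp: k_def intro!: ceiling_mono mult_left_mono)
      moreover have "(\<Sum>j\<in>?J. indicator (?A j) \<omega> * d (t n j) \<omega>) = (\<Sum>j\<in>?J. if k n \<omega> = j then d (t n j) \<omega> else 0)"
        using \<omega> by (intro sum.cong) (auto simp: indicator_def)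
      ultimately show "d (t n (k n \<omega>)) \<omega> = (\<Sum>j\<in>?J. indicator (?A j) \<omega> * d (t n j) \<omega>)"
        by (simp add: sum.delta')
    qed
    also have "\<dots> = (\<Sum>j\<in>?J. (LINT \<omega>|M. indicator (?A j) \<omega> * d (t n j) \<omega>))"
    proof (rule Bochner_Integration.integral_sum)
      fix j assume j: "j \<in> ?J"
      have "integrable M (d (t n j))"
        by (rule integrable_const_bound[of _ K]) (use j bounded[OF t_nonneg] d[OF t_nonneg] in auto)
      then show "integrable M (\<lambda>\<omega>. indicator (?A j) \<omega> * d (t n j) \<omega>)"
        using integrable_mult_indicator[OF A[OF j], of "d (t n j)"] by simp
    qed
    also have "\<dots> = 0"
      using zero[OF t_nonneg level] by (intro sum.neutral ballI) (auto simp: set_lebesgue_integral_def)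
    finally show ?thesis .
  qed
  have "(\<lambda>n. LINT \<omega>|M. d (t n (k n \<omega>)) \<omega>) \<longlonglongrightarrow> (LINT \<omega>|M. d (\<sigma> \<omega>) \<omega>)"
  proof (rule integral_dominated_convergence[where w="\<lambda>_. K"])
    show "AE \<omega> in M. (\<lambda>n. d (t n (k n \<omega>)) \<omega>) \<longlonglongrightarrow> d (\<sigma> \<omega>) \<omega>"
      unfolding k_def t_def
      by (intro AE_I2 right_continuous_grid_limit right) (use \<sigma> in auto)
    show "AE \<omega> in M. norm (d (t n (k n \<omega>)) \<omega>) \<le> K" for n
      using bounded[OF t_nonneg[OF k_nonneg]] by auto
  qed auto
  then show ?thesis
    unfolding zero_n by (simp add: LIMSEQ_const_iff)
qed

text \<open>Both costs are functions of one process \<open>u\<close>: stopping costs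
  \<open>u\<close> and waiting costs \<open>c * (1 - u)\<close> per unit of time. With
  \<open>u\<close> the posterior probability of no change this is the cost of the problem; with
  \<open>u\<close> the indicator of no change it is a functional of the hidden paths.\<close>

definition stopped_cost :: "real \<Rightarrow> (real \<Rightarrow> 'a \<Rightarrow> real) \<Rightarrow> ('a \<Rightarrow> real) \<Rightarrow> 'a \<Rightarrow> ennreal" where
  "stopped_cost c u \<sigma> \<omega> =
     ennreal (u (\<sigma> \<omega>) \<omega>) + (\<integral>\<^sup>+s\<in>{0..\<sigma> \<omega>}. ennreal (c * (1 - u s \<omega>)) \<partial>lborel)"

section \<open>Measurability of stopped costs\<close>

lemma stopped_running_cost_jointly_measurable:
  fixes u :: "real \<Rightarrow> 'a \<Rightarrow> real"
  assumes u: "\<And>t. 0 \<le> t \<Longrightarrow> u t \<in> borel_measurable M"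
      "\<And>t \<omega>. 0 \<le> t \<Longrightarrow> \<omega> \<in> space M \<Longrightarrow> ((\<lambda>s. u s \<omega>) \<longlongrightarrow> u t \<omega>) (at_right t)"
    and [measurable]: "\<sigma> \<in> borel_measurable M"
  shows "(\<lambda>(s, \<omega>). ennreal (c * (1 - u s \<omega>)) * indicator {0..\<sigma> \<omega>} s) \<in> borel_measurable (lborel \<Otimes>\<^sub>M M)"
proof -
  define g where "g = (\<lambda>(t, \<omega>). u (max 0 t) \<omega>)"
  have [measurable]: "g \<in> borel_measurable (lborel \<Otimes>\<^sub>M M)"
    using right_continuous_jointly_measurable[OF u] by (simp add: g_def cong: measurable_cong_sets)
  have "(\<lambda>z. ennreal (c * (1 - g z)) * (if 0 \<le> fst z \<and> fst z \<le> \<sigma> (snd z) then 1 else 0))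
      \<in> borel_measurable (lborel \<Otimes>\<^sub>M M)"
    by measurable
  then show ?thesis
    by (rule measurable_cong[THEN iffD1, rotated]) (auto simp: g_def indicator_def max_def)
qed

lemma stopped_running_cost_measurable:
  fixes u :: "real \<Rightarrow> 'a \<Rightarrow> real"
  assumes u: "\<And>t. 0 \<le> t \<Longrightarrow> u t \<in> borel_measurable M"
      "\<And>t \<omega>. 0 \<le> t \<Longrightarrow> \<omega> \<in> space M \<Longrightarrow> ((\<lambda>s. u s \<omega>) \<longlongrightarrow> u t \<omega>) (at_right t)"
    and \<sigma>: "\<sigma> \<in> borel_measurable M"
  shows "(\<lambda>\<omega>. \<integral>\<^sup>+s\<in>{0..\<sigma> \<omega>}. ennreal (c * (1 - u s \<omega>)) \<partial>lborel) \<in> borel_measurable M"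
proof -
  have "(\<lambda>(\<omega>, s). ennreal (c * (1 - u s \<omega>)) * indicator {0..\<sigma> \<omega>} s) \<in> borel_measurable (M \<Otimes>\<^sub>M lborel)"
    using measurable_compose[OF measurable_pair_swap' stopped_running_cost_jointly_measurable[OF u \<sigma>]]
    by (simp add: split_beta')
  then show ?thesis
    by (rule lborel.borel_measurable_nn_integral)
qed

lemma stopped_cost_measurable:
  fixes u :: "real \<Rightarrow> 'a \<Rightarrow> real"
  assumes u: "\<And>t. 0 \<le> t \<Longrightarrow> u t \<in> borel_measurable M"
      "\<And>t \<omega>. 0 \<le> t \<Longrightarrow> \<omega> \<in> space M \<Longrightarrow> ((\<lambda>s. u s \<omega>) \<longlongrightarrow> u t \<omega>) (at_right t)"
    and \<sigma>: "\<sigma> \<in> borel_measurable M" "\<And>\<omega>. \<omega> \<in> space M \<Longrightarrow> 0 \<le> \<sigma> \<omega>"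
  shows "stopped_cost c u \<sigma> \<in> borel_measurable M"
proof -
  have [measurable]: "(\<lambda>\<omega>. u (\<sigma> \<omega>) \<omega>) \<in> borel_measurable M"
    by (rule right_continuous_random_time_measurable[OF u \<sigma>])
  note [measurable] = stopped_running_cost_measurable[OF u \<sigma>(1)]
  show ?thesis
    unfolding stopped_cost_def[abs_def] by measurable
qed

text \<open>The terminal parts agree by the preceding result on stopped integrals, applied to
  \<open>u - v\<close>. The running parts agree by Fubini: at each fixed time \<open>s\<close> the
  event that \<open>s\<close> has not passed \<open>\<sigma>\<close> lies in \<open>F s\<close>, and
  over it \<open>u s\<close> and \<open>v s\<close> have the same integral.\<close>

lemma stopped_cost_cong:
  fixes u v :: "real \<Rightarrow> 'a \<Rightarrow> real" and \<sigma> :: "'a \<Rightarrow> real"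
  assumes M: "prob_space M"
    and F: "\<And>t. 0 \<le> t \<Longrightarrow> subalgebra M (F t)"
    and u: "\<And>t. 0 \<le> t \<Longrightarrow> u t \<in> borel_measurable M"
      "\<And>t \<omega>. 0 \<le> t \<Longrightarrow> \<omega> \<in> space M \<Longrightarrow> 0 \<le> u t \<omega> \<and> u t \<omega> \<le> 1"
      "\<And>t \<omega>. 0 \<le> t \<Longrightarrow> \<omega> \<in> space M \<Longrightarrow> ((\<lambda>s. u s \<omega>) \<longlongrightarrow> u t \<omega>) (at_right t)"
    and v: "\<And>t. 0 \<le> t \<Longrightarrow> v t \<in> borel_measurable M"
      "\<And>t \<omega>. 0 \<le> t \<Longrightarrow> \<omega> \<in> space M \<Longrightarrow> 0 \<le> v t \<omega> \<and> v t \<omega> \<le> 1"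
      "\<And>t \<omega>. 0 \<le> t \<Longrightarrow> \<omega> \<in> space M \<Longrightarrow> ((\<lambda>s. v s \<omega>) \<longlongrightarrow> v t \<omega>) (at_right t)"
    and eq: "\<And>t A. 0 \<le> t \<Longrightarrow> A \<in> sets (F t) \<Longrightarrow> (LINT \<omega>:A|M. u t \<omega>) = (LINT \<omega>:A|M. v t \<omega>)"
    and stop: "\<And>s t. 0 \<le> t \<Longrightarrow> s \<le> t \<Longrightarrow> {\<omega>\<in>space M. \<sigma> \<omega> \<le> s} \<in> sets (F t)"
    and \<sigma>: "\<sigma> \<in> borel_measurable M" "\<And>\<omega>. \<omega> \<in> space M \<Longrightarrow> 0 \<le> \<sigma> \<omega> \<and> \<sigma> \<omega> \<le> T"
    and c: "0 \<le> c"
  shows "(\<integral>\<^sup>+\<omega>. stopped_cost c u \<sigma> \<omega> \<partial>M) = (\<integral>\<^sup>+\<omega>. stopped_cost c v \<sigma> \<omega> \<partial>M)"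
proof -
  interpret prob_space M by (rule M)
  interpret pair_sigma_finite lborel M ..
  have int_u: "integrable M (u t)" and int_v: "integrable M (v t)" if "0 \<le> t" for t
    using u v that by (auto intro!: integrable_const_bound[of _ 1])
  have stopped: "(\<lambda>\<omega>. w (\<sigma> \<omega>) \<omega>) \<in> borel_measurable M \<and> integrable M (\<lambda>\<omega>. w (\<sigma> \<omega>) \<omega>)"
    if "\<And>t. 0 \<le> t \<Longrightarrow> w t \<in> borel_measurable M"
      "\<And>t \<omega>. 0 \<le> t \<Longrightarrow> \<omega> \<in> space M \<Longrightarrow> 0 \<le> w t \<omega> \<and> w t \<omega> \<le> 1"
      "\<And>t \<omega>. 0 \<le> t \<Longrightarrow> \<omega> \<in> space M \<Longrightarrow> ((\<lambda>s. w s \<omega>) \<longlongrightarrow> w t \<omega>) (at_right t)" for w :: "real \<Rightarrow> 'a \<Rightarrow> real"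
  proof -
    have "(\<lambda>\<omega>. w (\<sigma> \<omega>) \<omega>) \<in> borel_measurable M"
      by (rule right_continuous_random_time_measurable[OF that(1,3)]) (use \<sigma> in auto)
    then show ?thesis
      using that(2) \<sigma>(2) by (auto intro!: integrable_const_bound[of _ 1])
  qed
  have "(LINT \<omega>|M. u (\<sigma> \<omega>) \<omega> - v (\<sigma> \<omega>) \<omega>) = 0"
  proof (rule stopped_integral_eq_0[where d="\<lambda>t \<omega>. u t \<omega> - v t \<omega>" and K=1, OF M F _ _ _ _ stop \<sigma>])
    show "\<bar>u t \<omega> - v t \<omega>\<bar> \<le> 1" if "0 \<le> t" "\<omega> \<in> space M" for t \<omega>
      using u(2)[OF that] v(2)[OF that] by linarith
    show "(LINT \<omega>:A|M. u t \<omega> - v t \<omega>) = 0" if t: "0 \<le> t" and A: "A \<in> sets (F t)" for t A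
    proof -
      have "A \<in> sets M" using F[OF t] A by (auto simp: subalgebra_def)
      then show ?thesis
        using eq[OF t A] integrable_mult_indicator[OF _ int_u[OF t]] integrable_mult_indicator[OF _ int_v[OF t]]
        by (subst set_integral_diff) (simp_all add: set_integrable_def)
    qed
  qed (use u v in \<open>auto intro!: tendsto_diff\<close>)
  then have "(LINT \<omega>|M. u (\<sigma> \<omega>) \<omega>) = (LINT \<omega>|M. v (\<sigma> \<omega>) \<omega>)"
    using stopped[OF u] stopped[OF v] by simp
  moreover have "(\<integral>\<^sup>+\<omega>. ennreal (w (\<sigma> \<omega>) \<omega>) \<partial>M) = ennreal (LINT \<omega>|M. w (\<sigma> \<omega>) \<omega>)"
    if "integrable M (\<lambda>\<omega>. w (\<sigma> \<omega>) \<omega>)" "\<And>t \<omega>. 0 \<le> t \<Longrightarrow> \<omega> \<in> space M \<Longrightarrow> 0 \<le> w t \<omega> \<and> w t \<omega> \<le> 1"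
    for w :: "real \<Rightarrow> 'a \<Rightarrow> real"
    by (rule nn_integral_eq_integral[OF that(1)]) (use that(2) \<sigma> in auto)
  ultimately have terminal: "(\<integral>\<^sup>+\<omega>. ennreal (u (\<sigma> \<omega>) \<omega>) \<partial>M) = (\<integral>\<^sup>+\<omega>. ennreal (v (\<sigma> \<omega>) \<omega>) \<partial>M)"
    using stopped[OF u] stopped[OF v] u(2) v(2) by simp
  note [measurable] = \<sigma>(1)
  let ?R = "\<lambda>w s \<omega>. ennreal (c * (1 - w s \<omega>)) * indicator {0..\<sigma> \<omega>} s"
  have swap: "(\<integral>\<^sup>+\<omega>. (\<integral>\<^sup>+s. ?R w s \<omega> \<partial>lborel) \<partial>M) = (\<integral>\<^sup>+s. (\<integral>\<^sup>+\<omega>. ?R w s \<omega> \<partial>M) \<partial>lborel)"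
    if "\<And>t. 0 \<le> t \<Longrightarrow> w t \<in> borel_measurable M"
      "\<And>t \<omega>. 0 \<le> t \<Longrightarrow> \<omega> \<in> space M \<Longrightarrow> ((\<lambda>s. w s \<omega>) \<longlongrightarrow> w t \<omega>) (at_right t)" for w :: "real \<Rightarrow> 'a \<Rightarrow> real"
    using Fubini'[of "?R w"] stopped_running_cost_jointly_measurable[OF that \<sigma>(1)] by simp
  have slice: "(\<integral>\<^sup>+\<omega>. ?R u s \<omega> \<partial>M) = (\<integral>\<^sup>+\<omega>. ?R v s \<omega> \<partial>M)" for s
  proof (cases "0 \<le> s")
    case True
    let ?A = "{\<omega>\<in>space M. s \<le> \<sigma> \<omega>}"
    \<comment> \<open>Stopping exactly at \<open>s\<close> belongs to \<open>?A\<close>, so the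
      complement is the strict event \<open>\<sigma> \<omega> < s\<close>; it is a countable union
      of events decided strictly before \<open>s\<close>, hence known at \<open>s\<close>.\<close>
    have "?A = space M - (\<Union>m. {\<omega>\<in>space M. \<sigma> \<omega> \<le> s - 1 / real (Suc m)})"
    proof (intro set_eqI iffI)
      fix \<omega> assume \<omega>: "\<omega> \<in> space M - (\<Union>m. {\<omega>\<in>space M. \<sigma> \<omega> \<le> s - 1 / real (Suc m)})"
      show "\<omega> \<in> ?A"
      proof (rule ccontr)
        assume "\<omega> \<notin> ?A"
        then have "0 < s - \<sigma> \<omega>" using \<omega> by auto
        then obtain m where "1 / real (Suc m) < s - \<sigma> \<omega>"
          using nat_approx_posE by metis
        then show False using \<omega> by (auto simp del: of_nat_Suc dest!: spec[of _ m])
      qed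
    next
      fix \<omega> assume \<omega>: "\<omega> \<in> ?A"
      have "s - 1 / real (Suc m) < \<sigma> \<omega>" for m
      proof -
        have "0 < 1 / real (Suc m)" by simp
        moreover have "s \<le> \<sigma> \<omega>" using \<omega> by simp
        ultimately show ?thesis by linarith
      qed
      then show "\<omega> \<in> space M - (\<Union>m. {\<omega>\<in>space M. \<sigma> \<omega> \<le> s - 1 / real (Suc m)})"
        using \<omega> by (simp add: not_le del: of_nat_Suc)
    qed
    also have "\<dots> \<in> sets (F s)"
    proof -
      have "{\<omega>\<in>space M. \<sigma> \<omega> \<le> s - 1 / real (Suc m)} \<in> sets (F s)" for m
        by (rule stop[OF True]) simp
      moreover have "space M \<in> sets (F s)"
        using sets.top[of "F s"] F[OF True] unfolding subalgebra_def by metis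
      ultimately show ?thesis by (intro sets.Diff sets.countable_UN) auto
    qed
    finally have A: "?A \<in> sets (F s)" .
    then have A': "?A \<in> sets M" using F[OF True] by (auto simp: subalgebra_def)
    have "(\<integral>\<^sup>+\<omega>. ?R w s \<omega> \<partial>M) = ennreal (c * (measure M ?A - (LINT \<omega>:?A|M. w s \<omega>)))"
      if int: "integrable M (w s)" and w: "\<And>\<omega>. \<omega> \<in> space M \<Longrightarrow> 0 \<le> w s \<omega> \<and> w s \<omega> \<le> 1"
      for w :: "real \<Rightarrow> 'a \<Rightarrow> real"
    proof -
      have i: "integrable M (\<lambda>\<omega>. indicator ?A \<omega> * w s \<omega>)"
        using integrable_mult_indicator[OF A' int] by simp
      have iA: "integrable M (indicator ?A :: 'a \<Rightarrow> real)"
        using A' by (rule integrable_real_indicator) (simp add: less_top[symmetric])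
      have "(\<integral>\<^sup>+\<omega>. ?R w s \<omega> \<partial>M) = (\<integral>\<^sup>+\<omega>. ennreal (c * (indicator ?A \<omega> - indicator ?A \<omega> * w s \<omega>)) \<partial>M)"
        using True by (intro nn_integral_cong) (auto simp: indicator_def)
      also have "\<dots> = ennreal (LINT \<omega>|M. c * (indicator ?A \<omega> - indicator ?A \<omega> * w s \<omega>))"
      proof (rule nn_integral_eq_integral)
        show "integrable M (\<lambda>\<omega>. c * (indicator ?A \<omega> - indicator ?A \<omega> * w s \<omega>))"
          using iA i by (intro integrable_mult_right Bochner_Integration.integrable_diff)
        show "AE \<omega> in M. 0 \<le> c * (indicator ?A \<omega> - indicator ?A \<omega> * w s \<omega>)"
          using w c by (auto simp: indicator_def)
      qed
      also have "(LINT \<omega>|M. c * (indicator ?A \<omega> - indicator ?A \<omega> * w s \<omega>)) =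
          c * (measure M ?A - (LINT \<omega>:?A|M. w s \<omega>))"
        using Bochner_Integration.integral_diff[OF iA i] A' by (simp add: set_lebesgue_integral_def)
      finally show ?thesis .
    qed
    then show ?thesis
      using int_u[OF True] int_v[OF True] u(2)[OF True] v(2)[OF True] eq[OF True A] by simp
  qed simp
  have "(\<integral>\<^sup>+\<omega>. stopped_cost c w \<sigma> \<omega> \<partial>M) =
      (\<integral>\<^sup>+\<omega>. ennreal (w (\<sigma> \<omega>) \<omega>) \<partial>M) + (\<integral>\<^sup>+s. (\<integral>\<^sup>+\<omega>. ?R w s \<omega> \<partial>M) \<partial>lborel)"
    if w: "\<And>t. 0 \<le> t \<Longrightarrow> w t \<in> borel_measurable M"
      "\<And>t \<omega>. 0 \<le> t \<Longrightarrow> \<omega> \<in> space M \<Longrightarrow> ((\<lambda>s. w s \<omega>) \<longlongrightarrow> w t \<omega>) (at_right t)"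
      and m: "(\<lambda>\<omega>. w (\<sigma> \<omega>) \<omega>) \<in> borel_measurable M" for w :: "real \<Rightarrow> 'a \<Rightarrow> real"
    using m stopped_running_cost_measurable[OF w \<sigma>(1)]
    unfolding stopped_cost_def by (subst nn_integral_add) (auto simp: swap[OF w])
  then show ?thesis
    using stopped[OF u] stopped[OF v] u v terminal slice by simp
qed

section \<open>Laws of Markov chains and Brownian motions\<close>

lemma space_natural_filtration [simp]: "space (natural_filtration \<Omega> N X t) = \<Omega>"
  by (simp add: natural_filtration_def space_measure_of_conv)

lemma sets_natural_filtration:
  "sets (natural_filtration \<Omega> N X t) =
     sigma_sets \<Omega> {X s -` A \<inter> \<Omega> | s A. 0 \<le> s \<and> ennreal s \<le> t \<and> A \<in> sets N}"
  unfolding natural_filtration_def by (rule sets_measure_of) auto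

lemma natural_filtration_leI:
  assumes "space M = \<Omega>" "\<And>s. 0 \<le> s \<Longrightarrow> ennreal s \<le> t \<Longrightarrow> X s \<in> M \<rightarrow>\<^sub>M N"
  shows "sets (natural_filtration \<Omega> N X t) \<subseteq> sets M"
  unfolding sets_natural_filtration assms(1)[symmetric]
  by (rule sets.sigma_sets_subset) (auto intro: measurable_sets[OF assms(2)])

lemma measurable_natural_filtration:
  assumes "0 \<le> s" "ennreal s \<le> t" "space N = UNIV"
  shows "X s \<in> natural_filtration \<Omega> N X t \<rightarrow>\<^sub>M N"
  by (rule measurableI) (use assms in \<open>auto simp: sets_natural_filtration intro!: sigma_sets.Basic\<close>)

definition cylinders :: "'a set \<Rightarrow> 'b measure \<Rightarrow> (real \<Rightarrow> 'a \<Rightarrow> 'b) \<Rightarrow> 'a set set" where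
  "cylinders \<Omega> N X =
     {{\<omega>\<in>\<Omega>. \<forall>s\<in>T. X s \<omega> \<in> A s} | T A. finite T \<and> T \<subseteq> {0..} \<and> (\<forall>s. A s \<in> sets N)}"

lemma Int_stable_cylinders:
  assumes "space N = UNIV"
  shows "Int_stable (cylinders \<Omega> N X)"
proof (rule Int_stableI)
  fix a b assume "a \<in> cylinders \<Omega> N X" "b \<in> cylinders \<Omega> N X"
  then obtain T A T' A' where
    a: "a = {\<omega>\<in>\<Omega>. \<forall>s\<in>T. X s \<omega> \<in> A s}" "finite T" "T \<subseteq> {0..}" "\<And>s. A s \<in> sets N" and
    b: "b = {\<omega>\<in>\<Omega>. \<forall>s\<in>T'. X s \<omega> \<in> A' s}" "finite T'" "T' \<subseteq> {0..}" "\<And>s. A' s \<in> sets N"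
    by (auto simp: cylinders_def)
  let ?B = "\<lambda>s. (if s \<in> T then A s else UNIV) \<inter> (if s \<in> T' then A' s else UNIV)"
  have "UNIV \<in> sets N" using assms sets.top[of N] by simp
  then have "?B s \<in> sets N" for s using a(4) b(4) by auto
  moreover have "a \<inter> b = {\<omega>\<in>\<Omega>. \<forall>s\<in>T \<union> T'. X s \<omega> \<in> ?B s}"
    unfolding a(1) b(1) by auto
  ultimately show "a \<inter> b \<in> cylinders \<Omega> N X"
    unfolding cylinders_def using a b
    by (intro CollectI exI[of _ "T \<union> T'"] exI[of _ ?B]) auto
qed

lemma sets_natural_filtration_cylinders:
  assumes N: "space N = UNIV"
  shows "sets (natural_filtration \<Omega> N X \<infinity>) = sigma_sets \<Omega> (cylinders \<Omega> N X)"
proof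
  show "sets (natural_filtration \<Omega> N X \<infinity>) \<subseteq> sigma_sets \<Omega> (cylinders \<Omega> N X)"
    unfolding sets_natural_filtration
  proof (rule sigma_sets_mono, safe)
    fix s :: real and A assume "0 \<le> s" "A \<in> sets N"
    then have "X s -` A \<inter> \<Omega> \<in> cylinders \<Omega> N X"
      unfolding cylinders_def by (intro CollectI exI[of _ "{s}"] exI[of _ "\<lambda>_. A"]) auto
    then show "X s -` A \<inter> \<Omega> \<in> sigma_sets \<Omega> (cylinders \<Omega> N X)" by blast
  qed
  have "C \<in> sets (natural_filtration \<Omega> N X \<infinity>)" if C: "C \<in> cylinders \<Omega> N X" for C
  proof -
    let ?F = "natural_filtration \<Omega> N X \<infinity>"
    obtain T A where T: "C = {\<omega>\<in>\<Omega>. \<forall>s\<in>T. X s \<omega> \<in> A s}" "finite T" "T \<subseteq> {0..}" "\<And>s. A s \<in> sets N"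
      using C by (auto simp: cylinders_def)
    have "{\<omega>\<in>space ?F. \<forall>s\<in>T. X s \<omega> \<in> A s} \<in> sets ?F"
    proof (rule sets.sets_Collect_finite_All[OF _ T(2)])
      fix s assume "s \<in> T"
      then show "{\<omega>\<in>space ?F. X s \<omega> \<in> A s} \<in> sets ?F"
        using measurable_sets[OF measurable_natural_filtration[OF _ _ N, of s \<infinity> X \<Omega>] T(4), of s] T(3)
        by (auto simp: vimage_def Int_def conj_commute)
    qed
    then show ?thesis using T(1) by simp
  qed
  then show "sigma_sets \<Omega> (cylinders \<Omega> N X) \<subseteq> sets (natural_filtration \<Omega> N X \<infinity>)"
    using sets.sigma_sets_subset[of "cylinders \<Omega> N X" "natural_filtration \<Omega> N X \<infinity>"] by auto
qed

text \<open>Every cylinder may be assumed to inspect time 0, since the constraint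
  \<open>UNIV\<close> there changes nothing. A Markov chain then has its initial state on record,
  and a Brownian motion is inspected at least once.\<close>

lemma natural_filtration_mixture:
  fixes p q :: real
  assumes M: "prob_space M" "space M = \<Omega>" "sets (natural_filtration \<Omega> N X \<infinity>) \<subseteq> sets M"
    and M0: "prob_space M0" "space M0 = \<Omega>" "sets (natural_filtration \<Omega> N X \<infinity>) \<subseteq> sets M0"
    and M1: "prob_space M1" "space M1 = \<Omega>" "sets (natural_filtration \<Omega> N X \<infinity>) \<subseteq> sets M1"
    and N: "space N = UNIV"
    and pq: "p + q = 1"
    and eq: "\<And>T A. finite T \<Longrightarrow> 0 \<in> T \<Longrightarrow> T \<subseteq> {0..} \<Longrightarrow> (\<And>s. A s \<in> sets N) \<Longrightarrow>
      measure M {\<omega>\<in>\<Omega>. \<forall>s\<in>T. X s \<omega> \<in> A s} =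
        p * measure M0 {\<omega>\<in>\<Omega>. \<forall>s\<in>T. X s \<omega> \<in> A s} + q * measure M1 {\<omega>\<in>\<Omega>. \<forall>s\<in>T. X s \<omega> \<in> A s}"
    and A: "A \<in> sets (natural_filtration \<Omega> N X \<infinity>)"
  shows "measure M A = p * measure M0 A + q * measure M1 A"
proof (rule measure_mixture_sigma_sets[where G="cylinders \<Omega> N X" and \<Omega>=\<Omega>])
  fix C assume "C \<in> cylinders \<Omega> N X"
  then obtain T B where T: "C = {\<omega>\<in>\<Omega>. \<forall>s\<in>T. X s \<omega> \<in> B s}" "finite T" "T \<subseteq> {0..}" "\<And>s. B s \<in> sets N"
    by (auto simp: cylinders_def)
  have "C = {\<omega>\<in>\<Omega>. \<forall>s\<in>insert 0 T. X s \<omega> \<in> (if s \<in> T then B s else UNIV)}"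
    using T(1) by auto
  moreover have "(if s \<in> T then B s else UNIV) \<in> sets N" for s
    using T(4) sets.top[of N] N by auto
  ultimately show "measure M C = p * measure M0 C + q * measure M1 C"
    using eq[of "insert 0 T" "\<lambda>s. if s \<in> T then B s else UNIV"] T by simp
next
  show "cylinders \<Omega> N X \<subseteq> Pow \<Omega>" by (auto simp: cylinders_def)
qed (use assms Int_stable_cylinders[OF N] sets_natural_filtration_cylinders[OF N, of \<Omega> X] in auto)

section \<open>Finite-dimensional laws of the chains and of the Brownian motions\<close>

lemma markov_chain_measurable:
  assumes "markov_chain M {0, 1::nat} Q Y" "0 \<le> t"
  shows "Y t \<in> M \<rightarrow>\<^sub>M count_space UNIV"
proof -
  have "Y t \<in> M \<rightarrow>\<^sub>M count_space {0, 1}" using assms unfolding markov_chain_def by blast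
  then show ?thesis by (rule measurable_compose) simp
qed

lemma markov_chain_values:
  assumes "markov_chain M {0, 1::nat} Q Y" "0 \<le> t" "\<omega> \<in> space M"
  shows "Y t \<omega> = 0 \<or> Y t \<omega> = 1"
proof -
  have "Y t \<in> M \<rightarrow>\<^sub>M count_space {0, 1}" using assms unfolding markov_chain_def by blast
  from measurable_space[OF this assms(3)] show ?thesis by auto
qed

text \<open>Adding one later time multiplies the probability of a path by a transition factor that
  depends on \<open>Q\<close> and the path but not on \<open>M\<close>; this is how the initial law
  remains the only trace of the measure.\<close>

lemma markov_chain_path_step:
  assumes "markov_chain M {0, 1::nat} Q Y" "finite T" "0 \<in> T" "T \<subseteq> {0..}" "\<And>s. s \<in> T \<Longrightarrow> s < b"
    and "\<And>s. a s \<in> {0, 1}"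
  shows "measure M {\<omega>\<in>space M. \<forall>s\<in>insert b T. Y s \<omega> = a s} =
    measure M {\<omega>\<in>space M. \<forall>s\<in>T. Y s \<omega> = a s} * transition_prob {0, 1} Q (b - Max T) (a (Max T)) (a b)"
proof -
  define m where "m = Max T"
  have m: "m \<in> T" "\<And>s. s \<in> T \<Longrightarrow> s \<le> m"
    unfolding m_def using assms(2,3) by (auto intro: Max_in)
  have "T \<subseteq> {0..m}" "0 \<le> m" "0 \<le> b - m"
    using m assms(3-5) by (auto intro: less_imp_le)
  then have "measure M {\<omega>\<in>space M. (\<forall>s\<in>T. Y s \<omega> = a s) \<and> Y m \<omega> = a m \<and> Y (m + (b - m)) \<omega> = a b} =
      measure M {\<omega>\<in>space M. (\<forall>s\<in>T. Y s \<omega> = a s) \<and> Y m \<omega> = a m} * transition_prob {0, 1} Q (b - m) (a m) (a b)"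
    using assms(1,2,6) unfolding markov_chain_def by blast
  moreover have "{\<omega>\<in>space M. (\<forall>s\<in>T. Y s \<omega> = a s) \<and> Y m \<omega> = a m \<and> Y (m + (b - m)) \<omega> = a b} =
      {\<omega>\<in>space M. \<forall>s\<in>insert b T. Y s \<omega> = a s}"
    "{\<omega>\<in>space M. (\<forall>s\<in>T. Y s \<omega> = a s) \<and> Y m \<omega> = a m} = {\<omega>\<in>space M. \<forall>s\<in>T. Y s \<omega> = a s}"
    using m(1) by auto
  ultimately show ?thesis unfolding m_def by simp
qed

text \<open>Induction on the latest time: all three probabilities pick up the same transition
  factor, so the affine relation persists. It starts from the initial law, where state 0 is handled
  as the complement of state 1.\<close>

lemma markov_chain_path_mixture:
  fixes q :: real
  assumes M: "prob_space M" "markov_chain M {0, 1} Q Y" "space M = \<Omega>"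
    and M0: "prob_space M0" "markov_chain M0 {0, 1} Q Y" "space M0 = \<Omega>"
    and M1: "prob_space M1" "markov_chain M1 {0, 1} Q Y" "space M1 = \<Omega>"
    and init: "measure M {\<omega>\<in>\<Omega>. Y 0 \<omega> = 1} =
      (1 - q) * measure M0 {\<omega>\<in>\<Omega>. Y 0 \<omega> = 1} + q * measure M1 {\<omega>\<in>\<Omega>. Y 0 \<omega> = (1::nat)}"
    and T: "finite T" "T \<subseteq> {0<..}" and a: "\<And>s. a s \<in> {0, 1::nat}"
  shows "measure M {\<omega>\<in>\<Omega>. \<forall>s\<in>insert 0 T. Y s \<omega> = a s} =
      (1 - q) * measure M0 {\<omega>\<in>\<Omega>. \<forall>s\<in>insert 0 T. Y s \<omega> = a s} +
      q * measure M1 {\<omega>\<in>\<Omega>. \<forall>s\<in>insert 0 T. Y s \<omega> = a s}"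
  using T
proof (induction T rule: finite_linorder_max_induct)
  case empty
  have compl: "measure N {\<omega>\<in>\<Omega>. Y 0 \<omega> = 0} = 1 - measure N {\<omega>\<in>\<Omega>. Y 0 \<omega> = 1}"
    if N: "prob_space N" "markov_chain N {0, 1} Q Y" "space N = \<Omega>" for N
  proof -
    have "{\<omega>\<in>\<Omega>. Y 0 \<omega> = 1} \<in> sets N"
      using measurable_sets[OF markov_chain_measurable[OF N(2), of 0], of "{1}"] N(3)
      by (auto simp: vimage_def Int_def conj_commute)
    moreover have "{\<omega>\<in>\<Omega>. Y 0 \<omega> = 0} = \<Omega> - {\<omega>\<in>\<Omega>. Y 0 \<omega> = 1}"
      using markov_chain_values[OF N(2), of 0] N(3) by force
    ultimately show ?thesis using prob_space.prob_compl[OF N(1)] N(3) by simp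
  qed
  have "measure M {\<omega>\<in>\<Omega>. Y 0 \<omega> = 0} =
      (1 - q) * measure M0 {\<omega>\<in>\<Omega>. Y 0 \<omega> = 0} + q * measure M1 {\<omega>\<in>\<Omega>. Y 0 \<omega> = 0}"
    unfolding compl[OF M] compl[OF M0] compl[OF M1] init by (simp add: algebra_simps)
  moreover have "a 0 = 0 \<or> a 0 = 1" using a by auto
  ultimately show ?case using init by auto
next
  case (insert b T)
  have step: "measure N {\<omega>\<in>\<Omega>. \<forall>s\<in>insert b (insert 0 T). Y s \<omega> = a s} =
    measure N {\<omega>\<in>\<Omega>. \<forall>s\<in>insert 0 T. Y s \<omega> = a s} *
      transition_prob {0, 1} Q (b - Max (insert 0 T)) (a (Max (insert 0 T))) (a b)"
    if "markov_chain N {0, 1} Q Y" "space N = \<Omega>" for N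
    using markov_chain_path_step[OF that(1), of "insert 0 T" b a] a insert(1,2,4) that(2)
    by (auto intro: less_imp_le)
  have IH: "measure M {\<omega>\<in>\<Omega>. \<forall>s\<in>insert 0 T. Y s \<omega> = a s} =
      (1 - q) * measure M0 {\<omega>\<in>\<Omega>. \<forall>s\<in>insert 0 T. Y s \<omega> = a s} +
      q * measure M1 {\<omega>\<in>\<Omega>. \<forall>s\<in>insert 0 T. Y s \<omega> = a s}"
    using insert(3,4) by simp
  show ?case
    unfolding insert_commute[of 0 b T] step[OF M(2,3)] step[OF M0(2,3)] step[OF M1(2,3)] IH
    by (simp only: distrib_right mult.assoc)
qed

lemma markov_chain_mixture:
  fixes q :: real
  assumes M: "prob_space M" "markov_chain M {0, 1} Q Y" "space M = \<Omega>"
    and M0: "prob_space M0" "markov_chain M0 {0, 1} Q Y" "space M0 = \<Omega>"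
    and M1: "prob_space M1" "markov_chain M1 {0, 1} Q Y" "space M1 = \<Omega>"
    and init: "measure M {\<omega>\<in>\<Omega>. Y 0 \<omega> = 1} =
      (1 - q) * measure M0 {\<omega>\<in>\<Omega>. Y 0 \<omega> = 1} + q * measure M1 {\<omega>\<in>\<Omega>. Y 0 \<omega> = (1::nat)}"
    and A: "A \<in> sets (natural_filtration \<Omega> (count_space UNIV) Y \<infinity>)"
  shows "measure M A = (1 - q) * measure M0 A + q * measure M1 A"
proof (rule natural_filtration_mixture[OF M(1,3) _ M0(1,3) _ M1(1,3) _ _ _ _ A])
  show "sets (natural_filtration \<Omega> (count_space UNIV) Y \<infinity>) \<subseteq> sets M"
    "sets (natural_filtration \<Omega> (count_space UNIV) Y \<infinity>) \<subseteq> sets M0"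
    "sets (natural_filtration \<Omega> (count_space UNIV) Y \<infinity>) \<subseteq> sets M1"
    by (intro natural_filtration_leI M M0 M1 markov_chain_measurable[OF M(2)]
        markov_chain_measurable[OF M0(2)] markov_chain_measurable[OF M1(2)]; assumption)+
  fix T :: "real set" and B :: "real \<Rightarrow> nat set"
  assume T: "finite T" "0 \<in> T" "T \<subseteq> {0..}"
  define U where "U = T - {0}"
  have U: "finite U" "U \<subseteq> {0<..}" "T = insert 0 U"
    using T by (auto simp: U_def less_le)
  \<comment> \<open>Intersecting with the two states leaves finitely many paths, into which the
    cylinder splits disjointly.\<close>
  define paths where "paths = Pi\<^sub>E T (\<lambda>s. B s \<inter> {0, 1})"
  have fin: "finite paths"
    unfolding paths_def using T(1) by (intro finite_PiE) auto
  let ?P = "\<lambda>a. {\<omega>\<in>\<Omega>. \<forall>s\<in>T. Y s \<omega> = a s}"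
  have sum: "measure N {\<omega>\<in>\<Omega>. \<forall>s\<in>T. Y s \<omega> \<in> B s} = (\<Sum>a\<in>paths. measure N (?P a))"
    if N: "prob_space N" "markov_chain N {0, 1} Q Y" "space N = \<Omega>" for N
  proof -
    have "?P a \<in> sets N" for a
    proof -
      have "{\<omega>\<in>space N. Y s \<omega> = a s} \<in> sets N" if "s \<in> T" for s
        using measurable_sets[OF markov_chain_measurable[OF N(2), of s], of "{a s}"] that T(3)
        by (auto simp: vimage_def Int_def conj_commute)
      then show ?thesis
        using sets.sets_Collect_finite_All[OF _ T(1), of N] N(3) by simp
    qed
    moreover have "disjoint_family_on ?P paths"
      unfolding disjoint_family_on_def
    proof (intro ballI impI)
      fix a b assume "a \<in> paths" "b \<in> paths" "a \<noteq> b"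
      then obtain s where "s \<in> T" "a s \<noteq> b s"
        unfolding paths_def using PiE_ext by blast
      then show "?P a \<inter> ?P b = {}" by auto
    qed
    moreover have "{\<omega>\<in>\<Omega>. \<forall>s\<in>T. Y s \<omega> \<in> B s} = (\<Union>a\<in>paths. ?P a)"
    proof (intro set_eqI iffI)
      fix \<omega> assume \<omega>: "\<omega> \<in> {\<omega>\<in>\<Omega>. \<forall>s\<in>T. Y s \<omega> \<in> B s}"
      then have "restrict (\<lambda>s. Y s \<omega>) T \<in> paths"
        using markov_chain_values[OF N(2)] T(3) N(3) unfolding paths_def by force
      then show "\<omega> \<in> (\<Union>a\<in>paths. ?P a)"
        by (rule UN_I) (use \<omega> in auto)
    qed (auto simp: paths_def)
    ultimately show ?thesis
      using finite_measure.finite_measure_finite_Union[OF prob_space.finite_measure[OF N(1)] fin, of ?P] by auto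
  qed
  have "measure M (?P a) = (1 - q) * measure M0 (?P a) + q * measure M1 (?P a)" if "a \<in> paths" for a
  proof -
    \<comment> \<open>Outside \<open>T\<close> an extensional path is \<open>undefined\<close>,
      whereas the path lemma asks for a state at every time; 0 is an arbitrary choice.\<close>
    define a' where "a' s = (if s \<in> T then a s else 0)" for s
    have "a' s \<in> {0, 1}" for s
      using that by (auto simp: a'_def paths_def)
    moreover have "?P a = {\<omega>\<in>\<Omega>. \<forall>s\<in>insert 0 U. Y s \<omega> = a' s}"
      unfolding U(3)[symmetric] a'_def by auto
    ultimately show ?thesis
      using markov_chain_path_mixture[OF M M0 M1 init U(1,2), of a'] by simp
  qed
  then show "measure M {\<omega>\<in>\<Omega>. \<forall>s\<in>T. Y s \<omega> \<in> B s} =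
      (1 - q) * measure M0 {\<omega>\<in>\<Omega>. \<forall>s\<in>T. Y s \<omega> \<in> B s} + q * measure M1 {\<omega>\<in>\<Omega>. \<forall>s\<in>T. Y s \<omega> \<in> B s}"
    unfolding sum[OF M] sum[OF M0] sum[OF M1]
    by (simp add: sum.distrib sum_distrib_left)
qed simp_all

text \<open>Both sides equal one explicit product measure, built from the time points alone.\<close>

lemma brownian_motion_increments_law:
  assumes M: "prob_space M" "brownian_motion M W" and N: "prob_space N" "brownian_motion N W"
    and t: "0 \<le> t 0" "\<And>k. k < n \<Longrightarrow> t k \<le> t (Suc k)" and n: "n \<noteq> 0"
  shows "distr M (Pi\<^sub>M {..<n} (\<lambda>_. borel)) (\<lambda>\<omega>. \<lambda>k\<in>{..<n}. W (t (Suc k)) \<omega> - W (t k) \<omega>) =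
    distr N (Pi\<^sub>M {..<n} (\<lambda>_. borel)) (\<lambda>\<omega>. \<lambda>k\<in>{..<n}. W (t (Suc k)) \<omega> - W (t k) \<omega>)"
proof -
  have t_nonneg: "0 \<le> t k" if "k \<le> n" for k
    using that by (induction k) (use t in \<open>auto intro: order_trans\<close>)
  \<comment> \<open>Between equal times the increment is a point mass at 0, because the Gaussian
    clause of \<open>brownian_motion\<close> speaks only of \<open>s < t\<close>.\<close>
  define D where "D k = (if t k < t (Suc k) then density lborel (normal_density 0 (sqrt (t (Suc k) - t k)))
    else return borel 0)" for k
  have law: "distr K (Pi\<^sub>M {..<n} (\<lambda>_. borel)) (\<lambda>\<omega>. \<lambda>k\<in>{..<n}. W (t (Suc k)) \<omega> - W (t k) \<omega>) =
      Pi\<^sub>M {..<n} D" if K: "prob_space K" "brownian_motion K W" for K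
  proof -
    interpret prob_space K by (rule K)
    have rv: "W s \<in> borel_measurable K" if "0 \<le> s" for s
      using K(2) that by (simp add: brownian_motion_def)
    have incr: "distr K borel (\<lambda>\<omega>. W (t (Suc k)) \<omega> - W (t k) \<omega>) = D k" if k: "k < n" for k
    proof (cases "t k < t (Suc k)")
      case True
      then have "distributed K lborel (\<lambda>\<omega>. W (t (Suc k)) \<omega> - W (t k) \<omega>)
          (normal_density 0 (sqrt (t (Suc k) - t k)))"
        using K(2) t_nonneg[of k] k by (simp add: brownian_motion_def)
      then have "distr K lborel (\<lambda>\<omega>. W (t (Suc k)) \<omega> - W (t k) \<omega>) = D k"
        using True by (simp add: distributed_def D_def)
      then show ?thesis by (simp cong: distr_cong)
    next
      case False
      then have "t (Suc k) = t k" using t(2)[OF k] by simp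
      then show ?thesis by (simp add: D_def distr_const)
    qed
    have "indep_vars (\<lambda>_. borel) (\<lambda>k \<omega>. W (t (Suc k)) \<omega> - W (t k) \<omega>) {..<n}"
      using K(2) t unfolding brownian_motion_def by blast
    then have "distr K (Pi\<^sub>M {..<n} (\<lambda>_. borel)) (\<lambda>\<omega>. \<lambda>k\<in>{..<n}. W (t (Suc k)) \<omega> - W (t k) \<omega>) =
        Pi\<^sub>M {..<n} (\<lambda>k. distr K borel (\<lambda>\<omega>. W (t (Suc k)) \<omega> - W (t k) \<omega>))"
      by (subst (asm) indep_vars_iff_distr_eq_PiM')
        (use n t_nonneg in \<open>auto intro!: borel_measurable_diff rv\<close>)
    also have "\<dots> = Pi\<^sub>M {..<n} D"
      by (rule PiM_cong) (simp_all add: incr)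
    finally show ?thesis .
  qed
  show ?thesis by (simp add: law M N)
qed

text \<open>Since \<open>W\<close> starts at 0, its values are partial sums of increments, so a
  cylinder event is an event about increments, and their joint law is determined.\<close>

lemma brownian_motion_law:
  assumes M: "prob_space M" "brownian_motion M W" "space M = \<Omega>"
    and N: "prob_space N" "brownian_motion N W" "space N = \<Omega>"
    and A: "A \<in> sets (natural_filtration \<Omega> borel W \<infinity>)"
  shows "measure M A = measure N A"
proof -
  have rv: "W s \<in> borel_measurable K" if "brownian_motion K W" "0 \<le> s" for s K
    using that by (simp add: brownian_motion_def)
  have sub: "sets (natural_filtration \<Omega> borel W \<infinity>) \<subseteq> sets K"
    if "brownian_motion K W" "space K = \<Omega>" for K
    using rv that by (intro natural_filtration_leI) auto
  \<comment> \<open>Equality of two laws, written as a degenerate mixture so that the extension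
    lemma for mixtures applies.\<close>
  have "measure M A = 1 * measure N A + 0 * measure N A"
  proof (rule natural_filtration_mixture[OF M(1,3) sub[OF M(2,3)] N(1,3) sub[OF N(2,3)] N(1,3) sub[OF N(2,3)] _ _ _ A])
    fix T :: "real set" and B :: "real \<Rightarrow> real set"
    assume T: "finite T" "0 \<in> T" "T \<subseteq> {0..}" and B: "\<And>s. B s \<in> sets borel"
    define xs where "xs = sorted_list_of_set T"
    define n where "n = length xs"
    \<comment> \<open>With 0 put in front of the sorted times, \<open>W (xs ! k)\<close> telescopes
      into the first \<open>k + 1\<close> increments. As 0 already lies in \<open>T\<close>,
      \<open>t 0\<close> and \<open>t 1\<close> coincide and the first increment is
      degenerate.\<close>
    define t where "t k = (if k = 0 then 0 else xs ! (k - 1))" for k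
    have xs: "set xs = T" "sorted xs" using T(1) by (auto simp: xs_def)
    have t: "0 \<le> t 0" "t k \<le> t (Suc k)" if "k < n" for k
    proof -
      show "t k \<le> t (Suc k)"
        using that xs T(3) nth_mem[of 0 xs] sorted_nth_mono[OF xs(2), of "k - 1" k]
        by (cases k) (auto simp: t_def n_def)
    qed (simp add: t_def)
    have n: "n \<noteq> 0" using xs(1) T(2) by (auto simp: n_def)
    have t0: "0 \<le> t 0" by (simp add: t_def)
    define incr where "incr \<omega> = (\<lambda>k\<in>{..<n}. W (t (Suc k)) \<omega> - W (t k) \<omega>)" for \<omega>
    define R where "R = {x \<in> space (Pi\<^sub>M {..<n} (\<lambda>_. borel :: real measure)). \<forall>k\<in>{..<n}. (\<Sum>j<Suc k. x j) \<in> B (xs ! k)}"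
    have R: "R \<in> sets (Pi\<^sub>M {..<n} (\<lambda>_. borel))"
      unfolding R_def
    proof (rule sets.sets_Collect_finite_All)
      fix k assume k: "k \<in> {..<n}"
      have "(\<lambda>x. \<Sum>j<Suc k. x j) \<in> borel_measurable (Pi\<^sub>M {..<n} (\<lambda>_. borel :: real measure))"
        using k by (intro borel_measurable_sum measurable_component_singleton) auto
      from measurable_sets[OF this B[of "xs ! k"]]
      show "{x \<in> space (Pi\<^sub>M {..<n} (\<lambda>_. borel :: real measure)). (\<Sum>j<Suc k. x j) \<in> B (xs ! k)}
          \<in> sets (Pi\<^sub>M {..<n} (\<lambda>_. borel))"
        by (simp add: vimage_def Int_def conj_commute)
    qed simp
    have cyl: "measure K {\<omega>\<in>\<Omega>. \<forall>s\<in>T. W s \<omega> \<in> B s} = measure (distr K (Pi\<^sub>M {..<n} (\<lambda>_. borel)) incr) R"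
      if K: "prob_space K" "brownian_motion K W" "space K = \<Omega>" for K
    proof -
      have t_nonneg: "0 \<le> t k" if "k \<le> n" for k
        using that T(3) xs(1) nth_mem[of "k - 1" xs] by (auto simp: t_def n_def)
      have "incr \<in> K \<rightarrow>\<^sub>M Pi\<^sub>M {..<n} (\<lambda>_. borel)"
        unfolding incr_def
        by (intro measurable_restrict borel_measurable_diff rv[OF K(2)] t_nonneg) auto
      then have "measure (distr K (Pi\<^sub>M {..<n} (\<lambda>_. borel)) incr) R = measure K (incr -` R \<inter> space K)"
        using R by (rule measure_distr)
      moreover have "incr -` R \<inter> space K = {\<omega>\<in>\<Omega>. \<forall>s\<in>T. W s \<omega> \<in> B s}"
      proof -
        have "(\<Sum>j<Suc k. incr \<omega> j) = W (xs ! k) \<omega>" if "k < n" "\<omega> \<in> \<Omega>" for k \<omega>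
        proof -
          have "(\<Sum>j<Suc k. incr \<omega> j) = (\<Sum>j<Suc k. W (t (Suc j)) \<omega> - W (t j) \<omega>)"
            using that by (intro sum.cong) (auto simp: incr_def)
          also have "\<dots> = W (t (Suc k)) \<omega> - W (t 0) \<omega>"
            by (rule sum_lessThan_telescope)
          also have "W (t 0) \<omega> = 0"
            using K(2,3) that by (simp add: t_def brownian_motion_def)
          finally show ?thesis by (simp add: t_def)
        qed
        moreover have "incr \<omega> \<in> space (Pi\<^sub>M {..<n} (\<lambda>_. borel))" for \<omega>
          by (simp add: incr_def space_PiM)
        moreover have "(\<forall>s\<in>T. P s) \<longleftrightarrow> (\<forall>k<n. P (xs ! k))" for P
          unfolding xs(1)[symmetric] n_def by (metis in_set_conv_nth)
        ultimately show ?thesis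
          using K(3) by (auto simp: R_def)
      qed
      ultimately show ?thesis by simp
    qed
    have "distr M (Pi\<^sub>M {..<n} (\<lambda>_. borel)) incr = distr N (Pi\<^sub>M {..<n} (\<lambda>_. borel)) incr"
      unfolding incr_def by (rule brownian_motion_increments_law[OF M(1,2) N(1,2) t0 t(2)]) (use n in auto)
    then show "measure M {\<omega>\<in>\<Omega>. \<forall>s\<in>T. W s \<omega> \<in> B s} =
        1 * measure N {\<omega>\<in>\<Omega>. \<forall>s\<in>T. W s \<omega> \<in> B s} + 0 * measure N {\<omega>\<in>\<Omega>. \<forall>s\<in>T. W s \<omega> \<in> B s}"
      unfolding cyl[OF M] cyl[OF N] by simp
  qed simp_all
  then show ?thesis by simp
qed

section \<open>The detection model\<close>

lemma UNIV_2_pair: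
  assumes "i \<noteq> j"
  shows "(UNIV :: 2 set) = {i, j}"
proof -
  have "k = i \<or> k = j" for k :: 2
    using exhaust_2[of i] exhaust_2[of j] exhaust_2[of k] assms by auto
  then show ?thesis by blast
qed

lemma measurable_subsets:
  assumes "sets A \<subseteq> sets B" "space A = space B" "f \<in> A \<rightarrow>\<^sub>M N"
  shows "f \<in> B \<rightarrow>\<^sub>M N"
  using assms by (auto simp: measurable_def)

lemma borel_measurable_vec2:
  fixes f :: "'b \<Rightarrow> real^2"
  shows "f \<in> borel_measurable M \<longleftrightarrow> (\<forall>i. (\<lambda>x. f x $ i) \<in> borel_measurable M)"
  by (subst borel_measurable_euclidean_space) (auto simp: Basis_vec_def inner_axis)

lemma prob_space_sigma_finite_subalgebra:
  assumes "prob_space M" "subalgebra M F"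
  shows "sigma_finite_subalgebra M F"
proof -
  interpret prob_space M by fact
  interpret finite_measure_subalgebra M F by unfold_locales fact
  show ?thesis by (rule sigma_finite_subalgebra_axioms)
qed

context quickest_detection
begin

abbreviation X_coord :: "2 \<Rightarrow> real \<Rightarrow> 'a \<Rightarrow> real" where
  "X_coord i t \<omega> \<equiv> observation \<mu> Y W t \<omega> $ i"

abbreviation FX :: "ennreal \<Rightarrow> 'a measure" where
  "FX \<equiv> natural_filtration (space S) borel (observation \<mu> Y W)"

abbreviation FX_coord :: "2 \<Rightarrow> real \<Rightarrow> 'a measure" where
  "FX_coord i t \<equiv> natural_filtration (space S) borel (X_coord i) (ennreal t)"

definition FY :: "2 \<Rightarrow> 'a measure" where
  "FY i = natural_filtration (space S) (count_space UNIV) (Y i) \<infinity>"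

definition FW :: "2 \<Rightarrow> 'a measure" where
  "FW i = natural_filtration (space S) borel (W i) \<infinity>"

section \<open>The four independent sources and the sigma-algebras built from them\<close>

definition sources :: "2 + 2 \<Rightarrow> 'a measure" where
  "sources = case_sum FY FW"

text \<open>All that concerns coordinate \<open>i\<close>: its chain, its noise and hence its
  observation. The two algebras \<open>G 1\<close> and \<open>G 2\<close> are independent under
  every prior.\<close>

definition G :: "2 \<Rightarrow> 'a measure" where
  "G i = sigma (space S) (\<Union>k\<in>{Inl i, Inr i}. sets (sources k))"

text \<open>The sigma-algebra on which the laws under different priors can be compared. On the rest
  of \<open>S\<close> the measures \<open>P \<pi>\<close> are not tied to each other.\<close>

definition full :: "'a measure" where
  "full = sigma (space S) (\<Union>k. sets (sources k))"

lemma sources_simps [simp]: "sources (Inl i) = FY i" "sources (Inr i) = FW i"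
  by (simp_all add: sources_def)

lemma zero_in_box: "(0 :: real^2) \<in> cbox 0 1"
  by (simp add: mem_box_cart)

lemma space_P: "\<pi> \<in> cbox 0 1 \<Longrightarrow> space (P \<pi>) = space S"
  using sets_eq_imp_space_eq[OF sets_P] .

lemma measurable_P: "\<pi> \<in> cbox 0 1 \<Longrightarrow> (P \<pi> \<rightarrow>\<^sub>M N) = (S \<rightarrow>\<^sub>M N)"
  by (intro measurable_cong_sets sets_P) simp_all

lemma Y_measurable: "0 \<le> t \<Longrightarrow> Y i t \<in> S \<rightarrow>\<^sub>M count_space UNIV"
  using markov_chain_measurable[OF markov_chain_Y[OF zero_in_box]] measurable_P[OF zero_in_box] by auto

lemma Y_values: "0 \<le> t \<Longrightarrow> \<omega> \<in> space S \<Longrightarrow> Y i t \<omega> = 0 \<or> Y i t \<omega> = 1"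
  using markov_chain_values[OF markov_chain_Y[OF zero_in_box]] space_P[OF zero_in_box] by auto

lemma Y_right_continuous:
  assumes "0 \<le> t" "\<omega> \<in> space S"
  shows "((\<lambda>s. real (Y i s \<omega>)) \<longlongrightarrow> real (Y i t \<omega>)) (at_right t)"
proof (rule tendsto_eventually)
  have "\<forall>\<^sub>F s in at_right t. Y i s \<omega> = Y i t \<omega>"
    using markov_chain_Y[OF zero_in_box, of i] assms space_P[OF zero_in_box]
    unfolding markov_chain_def by blast
  then show "\<forall>\<^sub>F s in at_right t. real (Y i s \<omega>) = real (Y i t \<omega>)"
    by (rule eventually_mono) simp
qed

lemma W_measurable: "0 \<le> t \<Longrightarrow> W i t \<in> borel_measurable S"
  using brownian_motion_W[OF zero_in_box, of i] measurable_P[OF zero_in_box]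
  by (auto simp: brownian_motion_def)

lemma sets_FY: "sets (FY i) \<subseteq> sets S" and sets_FW: "sets (FW i) \<subseteq> sets S"
  unfolding FY_def FW_def
  by (rule natural_filtration_leI; auto intro: Y_measurable W_measurable)+

lemma space_FY [simp]: "space (FY i) = space S" and space_FW [simp]: "space (FW i) = space S"
  unfolding FY_def FW_def by (rule space_natural_filtration)+

lemma space_sources [simp]: "space (sources k) = space S"
  by (cases k) simp_all

lemma sets_sources: "sets (sources k) \<subseteq> sets S"
  using sets_FY sets_FW by (cases k) auto

lemma sources_Pow: "(\<Union>k\<in>K. sets (sources k)) \<subseteq> Pow (space S)"
  using sets_sources sets.space_closed[of S] by blast

lemma sets_G: "sets (G i) = sigma_sets (space S) (\<Union>k\<in>{Inl i, Inr i}. sets (sources k))"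
  unfolding G_def by (rule sets_measure_of[OF sources_Pow])

lemma sets_full: "sets full = sigma_sets (space S) (\<Union>k. sets (sources k))"
  unfolding full_def by (rule sets_measure_of[OF sources_Pow])

lemma space_G [simp]: "space (G i) = space S" and space_full [simp]: "space full = space S"
  unfolding G_def full_def by (simp_all add: space_measure_of_conv)

lemma sets_G_subset_full: "sets (G i) \<subseteq> sets full"
  unfolding sets_G sets_full by (rule sigma_sets_mono') blast

lemma sets_full_subset: "sets full \<subseteq> sets S"
  unfolding sets_full using sets_sources by (intro sets.sigma_sets_subset) blast

lemma Y_measurable_G:
  assumes "0 \<le> t"
  shows "Y i t \<in> G i \<rightarrow>\<^sub>M count_space UNIV"
proof (rule measurable_subsets[where A="FY i"])
  show "sets (FY i) \<subseteq> sets (G i)" unfolding sets_G by auto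
  show "Y i t \<in> FY i \<rightarrow>\<^sub>M count_space UNIV"
    unfolding FY_def by (rule measurable_natural_filtration) (use assms in auto)
qed simp

lemma W_measurable_G:
  assumes "0 \<le> t"
  shows "W i t \<in> borel_measurable (G i)"
proof (rule measurable_subsets[where A="FW i"])
  show "sets (FW i) \<subseteq> sets (G i)" unfolding sets_G by auto
  show "W i t \<in> borel_measurable (FW i)"
    unfolding FW_def by (rule measurable_natural_filtration) (use assms in auto)
qed simp

lemma real_Y_measurable_G: "0 \<le> t \<Longrightarrow> (\<lambda>\<omega>. real (Y i t \<omega>)) \<in> borel_measurable (G i)"
  by (rule measurable_compose[OF Y_measurable_G]) simp_all

lemma X_coord_measurable_G:
  assumes t: "0 \<le> t"
  shows "X_coord i t \<in> borel_measurable (G i)"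
proof -
  define g where "g = (\<lambda>(s, \<omega>). real (Y i (max 0 s) \<omega>))"
  have g: "g \<in> borel_measurable (borel \<Otimes>\<^sub>M G i)"
    unfolding g_def
    by (rule right_continuous_jointly_measurable[OF real_Y_measurable_G]) (auto intro: Y_right_continuous)
  have [measurable]: "(\<lambda>z. g (snd z, fst z)) \<in> borel_measurable (G i \<Otimes>\<^sub>M lborel)"
    using measurable_compose[OF measurable_pair_swap' g] by (simp add: split_beta' cong: measurable_cong_sets)
  have "(\<lambda>\<omega>. LINT s|lborel. (if 0 \<le> s \<and> s \<le> t then g (s, \<omega>) else 0)) \<in> borel_measurable (G i)"
    by (rule lborel.borel_measurable_lebesgue_integral) (simp add: split_beta')
  moreover have "(LINT s|lborel. (if 0 \<le> s \<and> s \<le> t then g (s, \<omega>) else 0)) = (LBINT s:{0..t}. real (Y i s \<omega>))" for \<omega>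
    unfolding set_lebesgue_integral_def
    by (rule Bochner_Integration.integral_cong) (auto simp: g_def indicator_def)
  ultimately have [measurable]: "(\<lambda>\<omega>. LBINT s:{0..t}. real (Y i s \<omega>)) \<in> borel_measurable (G i)"
    by simp
  note [measurable] = W_measurable_G[OF t, of i]
  show ?thesis
    unfolding observation_def by simp
qed

lemma sets_FX_coord: "sets (FX_coord i t) \<subseteq> sets (G i)"
  by (rule natural_filtration_leI) (auto intro: X_coord_measurable_G)

lemma sets_FX_subset_full: "sets (FX t) \<subseteq> sets full"
proof (rule natural_filtration_leI)
  fix s :: real assume "0 \<le> s"
  then show "observation \<mu> Y W s \<in> borel_measurable full"
    unfolding borel_measurable_vec2
    by (intro allI measurable_subsets[OF sets_G_subset_full _ X_coord_measurable_G]) simp_all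
qed simp

lemma sets_FX_mono: "s \<le> t \<Longrightarrow> sets (FX s) \<subseteq> sets (FX t)"
  unfolding sets_natural_filtration by (rule sigma_sets_mono') (auto intro: order_trans)

lemma subalgebra_full: "\<pi> \<in> cbox 0 1 \<Longrightarrow> subalgebra (P \<pi>) full"
  using sets_full_subset by (simp add: subalgebra_def space_P sets_P)

lemma subalgebra_FX: "\<pi> \<in> cbox 0 1 \<Longrightarrow> subalgebra (P \<pi>) (FX t)"
  using sets_FX_subset_full[of t] sets_full_subset by (auto simp: subalgebra_def space_P sets_P)

lemma subalgebra_FX_coord: "\<pi> \<in> cbox 0 1 \<Longrightarrow> subalgebra (P \<pi>) (FX_coord i t)"
  using sets_FX_coord[of i t] sets_G_subset_full[of i] sets_full_subset
  by (auto simp: subalgebra_def space_P sets_P)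

text \<open>An intersection-stable generator of the observations up to \<open>t\<close>, on which
  independence of the coordinates turns integrals of products into products of integrals.\<close>

definition rectangles :: "real \<Rightarrow> 'a set set" where
  "rectangles t = {\<Inter>i. A i | A. \<forall>i. A i \<in> sets (FX_coord i t)}"

lemma Int_stable_rectangles: "Int_stable (rectangles t)"
proof (rule Int_stableI)
  fix a b assume "a \<in> rectangles t" "b \<in> rectangles t"
  then obtain A B where "a = (\<Inter>i. A i)" "b = (\<Inter>i. B i)" "\<And>i. A i \<in> sets (FX_coord i t)" "\<And>i. B i \<in> sets (FX_coord i t)"
    unfolding rectangles_def by blast
  then show "a \<inter> b \<in> rectangles t"
    unfolding rectangles_def by (intro CollectI exI[of _ "\<lambda>i. A i \<inter> B i"]) auto
qed

lemma FX_coord_subset_rectangles: "sets (FX_coord i t) \<subseteq> rectangles t"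
proof
  fix B assume B: "B \<in> sets (FX_coord i t)"
  have "space S \<in> sets (FX_coord j t)" for j
    using sets.top[of "FX_coord j t"] by simp
  moreover have "(\<Inter>j. if j = i then B else space S) = B"
    using sets.sets_into_space[OF B] by (auto split: if_splits)
  ultimately show "B \<in> rectangles t"
    unfolding rectangles_def using B
    by (intro CollectI exI[of _ "\<lambda>j. if j = i then B else space S"]) auto
qed

lemma sets_FX_rectangles: "sets (FX (ennreal t)) \<subseteq> sigma_sets (space S) (rectangles t)"
proof -
  let ?R = "sigma (space S) (rectangles t)"
  have R: "rectangles t \<subseteq> Pow (space S)"
  proof
    fix a assume "a \<in> rectangles t"
    then obtain A where "a = (\<Inter>i. A i)" "\<forall>i. A i \<in> sets (FX_coord i t)"
      unfolding rectangles_def by blast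
    then show "a \<in> Pow (space S)"
      using sets.sets_into_space[of "A 1" "FX_coord 1 t"] by auto
  qed
  have "sets (FX (ennreal t)) \<subseteq> sets ?R"
  proof (rule natural_filtration_leI)
    fix s :: real assume s: "0 \<le> s" "ennreal s \<le> ennreal t"
    show "observation \<mu> Y W s \<in> borel_measurable ?R"
      unfolding borel_measurable_vec2
    proof
      fix i
      show "X_coord i s \<in> borel_measurable ?R"
      proof (rule measurable_subsets[where A="FX_coord i t"])
        show "sets (FX_coord i t) \<subseteq> sets ?R"
          using FX_coord_subset_rectangles R by (auto simp: sets_measure_of)
        show "X_coord i s \<in> borel_measurable (FX_coord i t)"
          by (rule measurable_natural_filtration) (use s in auto)
      qed (simp add: space_measure_of_conv)
    qed
  qed (simp add: space_measure_of_conv)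
  then show ?thesis using R by (simp add: sets_measure_of)
qed

section \<open>Laws under different priors\<close>

lemma prob_FY_mixture:
  assumes "\<pi> \<in> cbox 0 1" "\<pi>0 \<in> cbox 0 1" "\<pi>1 \<in> cbox 0 1"
    and "\<pi> $ i = (1 - q) * \<pi>0 $ i + q * \<pi>1 $ i" "A \<in> sets (FY i)"
  shows "measure (P \<pi>) A = (1 - q) * measure (P \<pi>0) A + q * measure (P \<pi>1) A"
proof (rule markov_chain_mixture)
  have init: "measure (P \<pi>') {\<omega>\<in>space S. Y i 0 \<omega> = 1} = \<pi>' $ i" if "\<pi>' \<in> cbox 0 1" for \<pi>'
    using initial_Y[OF that, of i] unfolding space_P[OF that] .
  show "measure (P \<pi>) {\<omega>\<in>space S. Y i 0 \<omega> = 1} =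
      (1 - q) * measure (P \<pi>0) {\<omega>\<in>space S. Y i 0 \<omega> = 1} + q * measure (P \<pi>1) {\<omega>\<in>space S. Y i 0 \<omega> = 1}"
    unfolding init[OF assms(1)] init[OF assms(2)] init[OF assms(3)] by (rule assms(4))
  show "A \<in> sets (natural_filtration (space S) (count_space UNIV) (Y i) \<infinity>)"
    using assms(5) unfolding FY_def .
qed (fact prob_space_P[OF assms(1)] prob_space_P[OF assms(2)] prob_space_P[OF assms(3)]
    markov_chain_Y[OF assms(1)] markov_chain_Y[OF assms(2)] markov_chain_Y[OF assms(3)]
    space_P[OF assms(1)] space_P[OF assms(2)] space_P[OF assms(3)])+

lemma prob_FY_cong:
  assumes "\<pi> \<in> cbox 0 1" "\<pi>' \<in> cbox 0 1" "\<pi> $ i = \<pi>' $ i" "A \<in> sets (FY i)"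
  shows "measure (P \<pi>) A = measure (P \<pi>') A"
proof -
  have "measure (P \<pi>) A = (1 - 0) * measure (P \<pi>') A + 0 * measure (P \<pi>') A"
    by (rule prob_FY_mixture[OF assms(1,2,2) _ assms(4)]) (use assms(3) in simp)
  then show ?thesis by simp
qed

lemma prob_FW_cong:
  assumes "\<pi> \<in> cbox 0 1" "\<pi>' \<in> cbox 0 1" "A \<in> sets (FW i)"
  shows "measure (P \<pi>) A = measure (P \<pi>') A"
  using assms(3) unfolding FW_def
  by (rule brownian_motion_law[OF prob_space_P[OF assms(1)] brownian_motion_W[OF assms(1)] space_P[OF assms(1)]
        prob_space_P[OF assms(2)] brownian_motion_W[OF assms(2)] space_P[OF assms(2)]])

lemma indep_sources:
  assumes "\<pi> \<in> cbox 0 1"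
  shows "prob_space.indep_sets (P \<pi>) (\<lambda>k. sets (sources k)) UNIV"
proof -
  have "(\<lambda>k. sets (sources k)) = case_sum (\<lambda>i. sets (FY i)) (\<lambda>i. sets (FW i))"
    by (auto simp: fun_eq_iff split: sum.split)
  then show ?thesis using indep_Y_W[OF assms] by (simp only: FY_def FW_def)
qed

text \<open>An intersection of one event per source has a product of four probabilities. Only the
  factor of chain \<open>i\<close> changes between the three priors, and it is affine; this is why
  just one coordinate may vary.\<close>

lemma prob_full_mixture:
  assumes \<pi>: "\<pi> \<in> cbox 0 1" "\<pi>0 \<in> cbox 0 1" "\<pi>1 \<in> cbox 0 1"
    and i: "\<pi> $ i = (1 - q) * \<pi>0 $ i + q * \<pi>1 $ i"
    and other: "\<And>j. j \<noteq> i \<Longrightarrow> \<pi> $ j = \<pi>0 $ j \<and> \<pi> $ j = \<pi>1 $ j"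
    and A: "A \<in> sets full"
  shows "measure (P \<pi>) A = (1 - q) * measure (P \<pi>0) A + q * measure (P \<pi>1) A"
proof (rule measure_mixture_sigma_sets[where \<Omega>="space S"])
  let ?E = "{\<Inter>k. E k | E. \<forall>k. E k \<in> sets (sources k)}"
  have E_S: "?E \<subseteq> sets S"
  proof
    fix a assume "a \<in> ?E"
    then obtain E where E: "a = (\<Inter>k. E k)" "\<forall>k. E k \<in> sets (sources k)" by blast
    have "(\<Inter>k. E k) \<in> sets S"
      using E(2) sets_sources by (intro sets.finite_INT) auto
    then show "a \<in> sets S" using E(1) by simp
  qed
  then show "?E \<subseteq> Pow (space S)" using sets.space_closed[of S] by blast
  show "Int_stable ?E"
  proof (rule Int_stableI)
    fix a b assume "a \<in> ?E" "b \<in> ?E"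
    then obtain E E' where E: "a = (\<Inter>k. E k)" "\<forall>k. E k \<in> sets (sources k)"
      and E': "b = (\<Inter>k. E' k)" "\<forall>k. E' k \<in> sets (sources k)"
      by blast
    then have "a \<inter> b = (\<Inter>k. E k \<inter> E' k)" "\<forall>k. E k \<inter> E' k \<in> sets (sources k)" by auto
    then show "a \<inter> b \<in> ?E" by blast
  qed
  have "sets full \<subseteq> sigma_sets (space S) ?E"
    unfolding sets_full
  proof (rule sigma_sets_mono', rule subsetI)
    fix B assume "B \<in> (\<Union>k. sets (sources k))"
    then obtain k where B: "B \<in> sets (sources k)" by blast
    define E where "E k' = (if k' = k then B else space S)" for k'
    have "E k' \<in> sets (sources k')" for k'
      using B sets.top[of "sources k'"] by (simp add: E_def)
    moreover have "(\<Inter>k'. E k') = B"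
      using sets.sets_into_space[OF B] by (auto simp: E_def split: if_splits)
    ultimately show "B \<in> ?E" by blast
  qed
  then show "A \<in> sigma_sets (space S) ?E" using A by blast
  from E_S have sub: "sigma_sets (space S) ?E \<subseteq> sets (P \<pi>')" if "\<pi>' \<in> cbox 0 1" for \<pi>'
    using sets.sigma_sets_subset sets_P[OF that] by simp
  show "sigma_sets (space S) ?E \<subseteq> sets (P \<pi>)" "sigma_sets (space S) ?E \<subseteq> sets (P \<pi>0)"
    "sigma_sets (space S) ?E \<subseteq> sets (P \<pi>1)"
    using \<pi> sub by auto
  fix B assume "B \<in> ?E"
  then obtain E where E: "B = (\<Inter>k. E k)" "\<forall>k. E k \<in> sets (sources k)" by blast
  have prod: "measure (P \<pi>') B = measure (P \<pi>') (E (Inl i)) * (\<Prod>k\<in>UNIV - {Inl i}. measure (P \<pi>') (E k))"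
    if "\<pi>' \<in> cbox 0 1" for \<pi>'
  proof -
    interpret prob_space "P \<pi>'" by (rule prob_space_P[OF that])
    have "prob B = (\<Prod>k\<in>UNIV. prob (E k))"
      using indep_setsD[OF indep_sources[OF that], of UNIV E] E by simp
    then show ?thesis by (simp add: prod.remove[of _ "Inl i"])
  qed
  have rest: "(\<Prod>k\<in>UNIV - {Inl i}. measure (P \<pi>) (E k)) = (\<Prod>k\<in>UNIV - {Inl i}. measure (P \<pi>') (E k))"
    if "\<pi>' = \<pi>0 \<or> \<pi>' = \<pi>1" for \<pi>'
  proof (rule prod.cong[OF refl])
    fix k :: "2 + 2" assume k: "k \<in> UNIV - {Inl i}"
    show "measure (P \<pi>) (E k) = measure (P \<pi>') (E k)"
    proof (cases k)
      case (Inl j)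
      then show ?thesis
        using k spec[OF E(2), of k] that \<pi> other[of j] by (intro prob_FY_cong[of _ _ j]) auto
    next
      case (Inr j)
      then show ?thesis
        using spec[OF E(2), of k] that \<pi> by (intro prob_FW_cong[of _ _ _ j]) auto
    qed
  qed
  have mix: "measure (P \<pi>) (E (Inl i)) = (1 - q) * measure (P \<pi>0) (E (Inl i)) + q * measure (P \<pi>1) (E (Inl i))"
    using spec[OF E(2), of "Inl i"] by (intro prob_FY_mixture[OF \<pi> i]) simp
  have rest0: "(\<Prod>k\<in>UNIV - {Inl i}. measure (P \<pi>0) (E k)) = (\<Prod>k\<in>UNIV - {Inl i}. measure (P \<pi>) (E k))"
    and rest1: "(\<Prod>k\<in>UNIV - {Inl i}. measure (P \<pi>1) (E k)) = (\<Prod>k\<in>UNIV - {Inl i}. measure (P \<pi>) (E k))"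
    using rest[of \<pi>0] rest[of \<pi>1] by simp_all
  show "measure (P \<pi>) B = (1 - q) * measure (P \<pi>0) B + q * measure (P \<pi>1) B"
    unfolding prod[OF \<pi>(1)] prod[OF \<pi>(2)] prod[OF \<pi>(3)] rest0 rest1 mix
    by (simp only: distrib_right mult.assoc)
qed (simp_all add: \<pi> prob_space_P space_P)

section \<open>Conditional independence of the coordinates\<close>

text \<open>The four independent sources are grouped into two disjoint pairs; independence survives
  passing to the sigma-algebras generated by the groups.\<close>

lemma indep_G:
  assumes \<pi>: "\<pi> \<in> cbox 0 1" and ij: "i \<noteq> j"
  shows "prob_space.indep_set (P \<pi>) (sets (G i)) (sets (G j))"
proof -
  interpret prob_space "P \<pi>" by (rule prob_space_P[OF \<pi>])
  let ?I = "\<lambda>i::2. {Inl i, Inr i} :: (2 + 2) set"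
  have "(\<Union>i. ?I i) = UNIV"
    by (auto simp: set_eq_iff) (metis sum.exhaust)
  then have "indep_sets (\<lambda>i. sigma_sets (space (P \<pi>)) (\<Union>k\<in>?I i. sets (sources k))) UNIV"
    using indep_sources[OF \<pi>]
    by (intro indep_sets_collect_sigma) (auto simp: disjoint_family_on_def intro: sets.Int_stable)
  then have G: "indep_sets (\<lambda>i. sets (G i)) UNIV"
    unfolding sets_G by (simp add: space_P[OF \<pi>])
  have "sets (G k) \<subseteq> events" for k
    using sets_G_subset_full[of k] sets_full_subset sets_P[OF \<pi>] by auto
  then show ?thesis
  proof (intro indep_setI)
    fix a b assume "a \<in> sets (G i)" "b \<in> sets (G j)"
    then have "prob (\<Inter>k\<in>{i, j}. if k = i then a else b) = (\<Prod>k\<in>{i, j}. prob (if k = i then a else b))"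
      using ij by (intro indep_setsD[OF G]) auto
    then show "prob (a \<inter> b) = prob a * prob b" using ij by (simp add: Int_commute)
  qed
qed

lemma indep_integral:
  fixes f g :: "'a \<Rightarrow> real"
  assumes \<pi>: "\<pi> \<in> cbox 0 1" and ij: "i \<noteq> j"
    and f: "f \<in> borel_measurable (G i)" "integrable (P \<pi>) f"
    and g: "g \<in> borel_measurable (G j)" "integrable (P \<pi>) g"
  shows "integrable (P \<pi>) (\<lambda>\<omega>. f \<omega> * g \<omega>)"
    and "(LINT \<omega>|P \<pi>. f \<omega> * g \<omega>) = (LINT \<omega>|P \<pi>. f \<omega>) * (LINT \<omega>|P \<pi>. g \<omega>)"
proof -
  interpret prob_space "P \<pi>" by (rule prob_space_P[OF \<pi>])
  have sub: "sigma_sets (space (P \<pi>)) {h -` A \<inter> space (P \<pi>) | A. A \<in> sets borel} \<subseteq> sets (G k)"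
    if "h \<in> borel_measurable (G k)" for h :: "'a \<Rightarrow> real" and k
  proof -
    have "sigma_sets (space (G k)) {h -` A \<inter> space (G k) | A. A \<in> sets borel} \<subseteq> sets (G k)"
      using measurable_sets[OF that] by (intro sets.sigma_sets_subset) auto
    then show ?thesis by (simp add: space_P[OF \<pi>])
  qed
  have "indep_var borel f borel g"
    unfolding indep_var_eq
  proof (intro conjI)
    show "indep_set (sigma_sets (space (P \<pi>)) {f -` A \<inter> space (P \<pi>) | A. A \<in> sets borel})
        (sigma_sets (space (P \<pi>)) {g -` A \<inter> space (P \<pi>) | A. A \<in> sets borel})"
      using indep_G[OF \<pi> ij] unfolding indep_set_def
      by (rule indep_sets_mono_sets) (use sub[OF f(1)] sub[OF g(1)] in \<open>simp split: bool.split\<close>)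
  qed (use f g in auto)
  then show "integrable (P \<pi>) (\<lambda>\<omega>. f \<omega> * g \<omega>)"
    "(LINT \<omega>|P \<pi>. f \<omega> * g \<omega>) = (LINT \<omega>|P \<pi>. f \<omega>) * (LINT \<omega>|P \<pi>. g \<omega>)"
    using f(2) g(2) by (simp_all add: indep_var_integrable indep_var_lebesgue_integral)
qed

text \<open>Conditioning on the observation of coordinate \<open>i\<close> alone keeps the process
  measurable with respect to \<open>G i\<close>, hence independent of the other coordinate. It turns
  out to be almost surely the posterior given both observations.\<close>

definition coord_posterior :: "real^2 \<Rightarrow> 2 \<Rightarrow> real \<Rightarrow> 'a \<Rightarrow> real" where
  "coord_posterior \<pi> i t = real_cond_exp (P \<pi>) (FX_coord i t) (\<lambda>\<omega>. real (Y i t \<omega>))"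

lemma sigma_finite_FX_coord: "\<pi> \<in> cbox 0 1 \<Longrightarrow> sigma_finite_subalgebra (P \<pi>) (FX_coord i t)"
  by (intro prob_space_sigma_finite_subalgebra prob_space_P subalgebra_FX_coord)

lemma sigma_finite_FX: "\<pi> \<in> cbox 0 1 \<Longrightarrow> sigma_finite_subalgebra (P \<pi>) (FX s)"
  by (intro prob_space_sigma_finite_subalgebra prob_space_P subalgebra_FX)

lemma Y_integrable:
  assumes "\<pi> \<in> cbox 0 1" "0 \<le> t"
  shows "integrable (P \<pi>) (\<lambda>\<omega>. real (Y i t \<omega>))"
proof -
  interpret prob_space "P \<pi>" by (rule prob_space_P[OF assms(1)])
  have "(\<lambda>\<omega>. real (Y i t \<omega>)) \<in> borel_measurable (P \<pi>)"
    unfolding measurable_P[OF assms(1)]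
    by (rule measurable_compose[OF Y_measurable[OF assms(2)]]) simp
  then show ?thesis
    using Y_values[OF assms(2), of _ i]
    by (intro integrable_const_bound[of _ 1]) (auto simp: space_P[OF assms(1)] intro!: AE_I2, force)
qed

lemma coord_posterior_measurable: "coord_posterior \<pi> i t \<in> borel_measurable (FX_coord i t)"
  unfolding coord_posterior_def by simp

lemma coord_posterior_measurable_G: "coord_posterior \<pi> i t \<in> borel_measurable (G i)"
  by (rule measurable_subsets[OF sets_FX_coord _ coord_posterior_measurable]) simp

lemma coord_posterior_integrable:
  assumes "\<pi> \<in> cbox 0 1" "0 \<le> t"
  shows "integrable (P \<pi>) (coord_posterior \<pi> i t)"
  unfolding coord_posterior_def
  by (rule sigma_finite_subalgebra.real_cond_exp_int(1)[OF sigma_finite_FX_coord Y_integrable])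
    (use assms in auto)

lemma coord_posterior_set_integral:
  assumes "\<pi> \<in> cbox 0 1" "0 \<le> t" "A \<in> sets (FX_coord i t)"
  shows "(LINT \<omega>:A|P \<pi>. coord_posterior \<pi> i t \<omega>) = (LINT \<omega>:A|P \<pi>. real (Y i t \<omega>))"
  unfolding coord_posterior_def
  by (rule sigma_finite_subalgebra.real_cond_exp_intA[OF sigma_finite_FX_coord Y_integrable, symmetric])
    (use assms in auto)

lemma sets_FX_coord_P: "\<pi> \<in> cbox 0 1 \<Longrightarrow> A \<in> sets (FX_coord i t) \<Longrightarrow> A \<in> sets (P \<pi>)"
  using subalgebra_FX_coord unfolding subalgebra_def by blast

lemma indicator_mult_G:
  fixes f :: "'a \<Rightarrow> real"
  assumes "\<pi> \<in> cbox 0 1" "A \<in> sets (FX_coord i t)" "f \<in> borel_measurable (G i)" "integrable (P \<pi>) f"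
  shows "(\<lambda>\<omega>. indicator A \<omega> * f \<omega>) \<in> borel_measurable (G i)"
    and "integrable (P \<pi>) (\<lambda>\<omega>. indicator A \<omega> * f \<omega>)"
proof -
  have "A \<in> sets (G i)" using sets_FX_coord assms(2) by blast
  then show "(\<lambda>\<omega>. indicator A \<omega> * f \<omega>) \<in> borel_measurable (G i)"
    using assms(3) by (intro borel_measurable_times borel_measurable_indicator)
  show "integrable (P \<pi>) (\<lambda>\<omega>. indicator A \<omega> * f \<omega>)"
    using integrable_mult_indicator[OF sets_FX_coord_P[OF assms(1,2)] assms(4)] by simp
qed

lemma rectangle_eq:
  assumes "i \<noteq> j"
  shows "(\<Inter>k. A k) = A i \<inter> A (j :: 2)"
  unfolding UNIV_2_pair[OF assms] by auto

lemma rectangles_P: "\<pi> \<in> cbox 0 1 \<Longrightarrow> rectangles t \<subseteq> sets (P \<pi>)"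
  using sets_FX_coord_P unfolding rectangles_def by (auto intro!: sets.finite_INT)

lemma rectangle_integral:
  fixes f g :: "'a \<Rightarrow> real"
  assumes \<pi>: "\<pi> \<in> cbox 0 1" and ij: "i \<noteq> j"
    and f: "f \<in> borel_measurable (G i)" "integrable (P \<pi>) f"
    and g: "g \<in> borel_measurable (G j)" "integrable (P \<pi>) g"
    and A: "\<And>k. A k \<in> sets (FX_coord k t)"
  shows "(LINT \<omega>:(\<Inter>k. A k)|P \<pi>. f \<omega> * g \<omega>) = (LINT \<omega>:A i|P \<pi>. f \<omega>) * (LINT \<omega>:A j|P \<pi>. g \<omega>)"
proof -
  have "(LINT \<omega>:(\<Inter>k. A k)|P \<pi>. f \<omega> * g \<omega>) =
      (LINT \<omega>|P \<pi>. (indicator (A i) \<omega> * f \<omega>) * (indicator (A j) \<omega> * g \<omega>))"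
    unfolding set_lebesgue_integral_def rectangle_eq[OF ij, of A]
    by (rule Bochner_Integration.integral_cong) (auto simp: indicator_def)
  also have "\<dots> = (LINT \<omega>|P \<pi>. indicator (A i) \<omega> * f \<omega>) * (LINT \<omega>|P \<pi>. indicator (A j) \<omega> * g \<omega>)"
    by (rule indep_integral(2)[OF \<pi> ij]) (use indicator_mult_G[OF \<pi> A] f g in auto)
  finally show ?thesis by (simp add: set_lebesgue_integral_def)
qed

lemma integrable_const_P [simp]: "\<pi> \<in> cbox 0 1 \<Longrightarrow> integrable (P \<pi>) (\<lambda>_. a :: real)"
  using prob_space.finite_measure[OF prob_space_P] by (simp add: finite_measure.integrable_const)

text \<open>The other observation is independent of chain \<open>i\<close> and its own observation,
  so it adds no information. Formally, the difference \<open>?d\<close> integrates to 0 over every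
  rectangle, hence over every event of the joint filtration.\<close>

lemma Post_eq_coord_posterior:
  assumes \<pi>: "\<pi> \<in> cbox 0 1" and t: "0 \<le> t"
  shows "AE \<omega> in P \<pi>. Post \<pi> t \<omega> $ i = coord_posterior \<pi> i t \<omega>"
proof -
  interpret sigma_finite_subalgebra "P \<pi>" "FX (ennreal t)" by (rule sigma_finite_FX[OF \<pi>])
  obtain j where ij: "i \<noteq> j" using that[of 1] that[of 2] by (cases "i = 1") auto
  let ?d = "\<lambda>\<omega>. real (Y i t \<omega>) - coord_posterior \<pi> i t \<omega>"
  have d: "?d \<in> borel_measurable (G i)" "integrable (P \<pi>) ?d"
    using real_Y_measurable_G[OF t] coord_posterior_measurable_G Y_integrable[OF \<pi> t] coord_posterior_integrable[OF \<pi> t]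
    by auto
  have d0: "(LINT \<omega>:A|P \<pi>. ?d \<omega>) = 0" if "A \<in> sets (FX_coord i t)" for A
    using coord_posterior_set_integral[OF \<pi> t that]
      set_integral_diff_integrable[OF sets_FX_coord_P[OF \<pi> that] Y_integrable[OF \<pi> t] coord_posterior_integrable[OF \<pi> t]]
    by simp
  have zero: "(LINT \<omega>:A|P \<pi>. ?d \<omega>) = 0" if A: "A \<in> rectangles t" for A
  proof -
    obtain B where B: "A = (\<Inter>k. B k)" "\<And>k. B k \<in> sets (FX_coord k t)"
      using A unfolding rectangles_def by blast
    \<comment> \<open>The constant function 1 serves as the factor of the other coordinate; the
      first factor on the right vanishes by \<open>d0\<close>.\<close>
    have "(LINT \<omega>:(\<Inter>k. B k)|P \<pi>. ?d \<omega> * 1) = (LINT \<omega>:B i|P \<pi>. ?d \<omega>) * (LINT \<omega>:B j|P \<pi>. 1)"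
      by (rule rectangle_integral[OF \<pi> ij d _ _ B(2)]) (use \<pi> in auto)
    then show ?thesis using d0[OF B(2)] B(1) by simp
  qed
  have total: "(LINT \<omega>|P \<pi>. ?d \<omega>) = 0"
    using d0[of "space S"] sets.top[of "FX_coord i t"] set_integral_space[OF d(2)] space_P[OF \<pi>] by simp
  have zero_FX: "(LINT \<omega>:A|P \<pi>. ?d \<omega>) = 0" if "A \<in> sets (FX (ennreal t))" for A
  proof (rule set_integral_eq_0_sigma_sets[OF d(2) Int_stable_rectangles rectangles_P[OF \<pi>] zero total])
    show "A \<in> sigma_sets (space (P \<pi>)) (rectangles t)"
      using sets_FX_rectangles[of t] that by (auto simp: space_P[OF \<pi>])
  qed
  have "AE \<omega> in P \<pi>. real_cond_exp (P \<pi>) (FX (ennreal t)) (\<lambda>\<omega>. real (Y i t \<omega>)) \<omega> = coord_posterior \<pi> i t \<omega>"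
  proof (rule real_cond_exp_charact)
    show "(LINT \<omega>:A|P \<pi>. real (Y i t \<omega>)) = (LINT \<omega>:A|P \<pi>. coord_posterior \<pi> i t \<omega>)"
      if A: "A \<in> sets (FX (ennreal t))" for A
    proof -
      have "A \<in> sets (P \<pi>)" using A subalg unfolding subalgebra_def by blast
      then have "(LINT \<omega>:A|P \<pi>. ?d \<omega>) = (LINT \<omega>:A|P \<pi>. real (Y i t \<omega>)) - (LINT \<omega>:A|P \<pi>. coord_posterior \<pi> i t \<omega>)"
        by (intro set_integral_diff_integrable Y_integrable coord_posterior_integrable \<pi> t)
      then show ?thesis using zero_FX[OF A] by simp
    qed
    show "coord_posterior \<pi> i t \<in> borel_measurable (FX (ennreal t))"
    proof (rule measurable_subsets[OF _ _ coord_posterior_measurable])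
      show "sets (FX_coord i t) \<subseteq> sets (FX (ennreal t))"
      proof (rule natural_filtration_leI)
        fix s :: real assume "0 \<le> s" "ennreal s \<le> ennreal t"
        then have "observation \<mu> Y W s \<in> borel_measurable (FX (ennreal t))"
          by (intro measurable_natural_filtration) auto
        then show "X_coord i s \<in> borel_measurable (FX (ennreal t))"
          unfolding borel_measurable_vec2 by blast
      qed simp
    qed simp
  qed (use Y_integrable[OF \<pi> t] coord_posterior_integrable[OF \<pi> t] in auto)
  then show ?thesis
    using posterior_Post[OF \<pi> t, of i] by eventually_elim simp
qed

text \<open>The prior-free counterpart of \<open>stop_cost (Post \<pi> t)\<close>: the indicator
  that both chains are still in state 0.\<close>

definition no_change :: "real \<Rightarrow> 'a \<Rightarrow> real" where
  "no_change t \<omega> = (1 - real (Y 1 t \<omega>)) * (1 - real (Y 2 t \<omega>))"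

text \<open>Conditional independence in integrated form: over a rectangle both sides factor by
  coordinate, and the factors agree by the defining property of the one-coordinate posteriors. The
  pi-system argument extends this to all observable events.\<close>

lemma stop_cost_Post_set_integral:
  assumes \<pi>: "\<pi> \<in> cbox 0 1" and t: "0 \<le> t" and A: "A \<in> sets (FX (ennreal t))"
  shows "(LINT \<omega>:A|P \<pi>. stop_cost (Post \<pi> t \<omega>)) = (LINT \<omega>:A|P \<pi>. no_change t \<omega>)"
proof -
  let ?y = "\<lambda>i \<omega>. 1 - real (Y i t \<omega>)" and ?z = "\<lambda>i \<omega>. 1 - coord_posterior \<pi> i t \<omega>"
  have y: "?y i \<in> borel_measurable (G i)" "integrable (P \<pi>) (?y i)" for i
    using real_Y_measurable_G[OF t] Y_integrable[OF \<pi> t] \<pi> by auto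
  have z: "?z i \<in> borel_measurable (G i)" "integrable (P \<pi>) (?z i)" for i
    using coord_posterior_measurable_G coord_posterior_integrable[OF \<pi> t] \<pi> by auto
  have yz: "(LINT \<omega>:B|P \<pi>. ?y i \<omega>) = (LINT \<omega>:B|P \<pi>. ?z i \<omega>)" if B: "B \<in> sets (FX_coord i t)" for B i
  proof -
    have BP: "B \<in> sets (P \<pi>)" by (rule sets_FX_coord_P[OF \<pi> B])
    show ?thesis
      unfolding set_integral_diff_integrable[OF BP integrable_const_P[OF \<pi>] Y_integrable[OF \<pi> t]]
        set_integral_diff_integrable[OF BP integrable_const_P[OF \<pi>] coord_posterior_integrable[OF \<pi> t]]
      using coord_posterior_set_integral[OF \<pi> t B] by simp
  qed
  have ne: "(1::2) \<noteq> 2" by simp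
  let ?d = "\<lambda>\<omega>. ?z 1 \<omega> * ?z 2 \<omega> - ?y 1 \<omega> * ?y 2 \<omega>"
  note int_z = indep_integral(1)[OF \<pi> ne z z] and int_y = indep_integral(1)[OF \<pi> ne y y]
  have d: "integrable (P \<pi>) ?d" using int_y int_z by auto
  have diff: "(LINT \<omega>:B|P \<pi>. ?d \<omega>) = (LINT \<omega>:B|P \<pi>. ?z 1 \<omega> * ?z 2 \<omega>) - (LINT \<omega>:B|P \<pi>. ?y 1 \<omega> * ?y 2 \<omega>)"
    if "B \<in> sets (P \<pi>)" for B
    by (rule set_integral_diff_integrable[OF that int_z int_y])
  have rect: "(LINT \<omega>:B|P \<pi>. ?d \<omega>) = 0" if B: "B \<in> rectangles t" for B
  proof -
    obtain C where C: "B = (\<Inter>k. C k)" "\<And>k. C k \<in> sets (FX_coord k t)"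
      using B unfolding rectangles_def by blast
    have "(LINT \<omega>:B|P \<pi>. ?z 1 \<omega> * ?z 2 \<omega>) = (LINT \<omega>:B|P \<pi>. ?y 1 \<omega> * ?y 2 \<omega>)"
      unfolding C(1) rectangle_integral[OF \<pi> ne z z C(2)] rectangle_integral[OF \<pi> ne y y C(2)]
      by (simp only: yz[OF C(2)])
    moreover have "B \<in> sets (P \<pi>)" using B rectangles_P[OF \<pi>] by blast
    ultimately show ?thesis using diff by simp
  qed
  have "space S \<in> rectangles t"
    using FX_coord_subset_rectangles[of 1 t] sets.top[of "FX_coord 1 t"] by auto
  then have "(LINT \<omega>|P \<pi>. ?d \<omega>) = 0"
    using rect[of "space S"] set_integral_space[OF d] by (simp add: space_P[OF \<pi>])
  then have "(LINT \<omega>:A|P \<pi>. ?d \<omega>) = 0"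
    using sets_FX_rectangles[of t] A
    by (intro set_integral_eq_0_sigma_sets[OF d Int_stable_rectangles rectangles_P[OF \<pi>] rect])
      (auto simp: space_P[OF \<pi>])
  moreover have AP: "A \<in> sets (P \<pi>)" using A subalgebra_FX[OF \<pi>] unfolding subalgebra_def by blast
  moreover have "(LINT \<omega>:A|P \<pi>. stop_cost (Post \<pi> t \<omega>)) = (LINT \<omega>:A|P \<pi>. ?z 1 \<omega> * ?z 2 \<omega>)"
    unfolding set_lebesgue_integral_def
  proof (rule integral_cong_AE)
    show "AE \<omega> in P \<pi>. indicator A \<omega> *\<^sub>R stop_cost (Post \<pi> t \<omega>) = indicator A \<omega> *\<^sub>R (?z 1 \<omega> * ?z 2 \<omega>)"
      using Post_eq_coord_posterior[OF \<pi> t, of 1] Post_eq_coord_posterior[OF \<pi> t, of 2]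
      by eventually_elim (simp add: stop_cost_def)
    have "(\<lambda>\<omega>. Post \<pi> t \<omega> $ i) \<in> borel_measurable (P \<pi>)" for i
      using measurable_Post[OF \<pi> t] unfolding borel_measurable_vec2 by blast
    then show "(\<lambda>\<omega>. indicator A \<omega> *\<^sub>R stop_cost (Post \<pi> t \<omega>)) \<in> borel_measurable (P \<pi>)"
      using AP unfolding stop_cost_def by simp
    show "(\<lambda>\<omega>. indicator A \<omega> *\<^sub>R (?z 1 \<omega> * ?z 2 \<omega>)) \<in> borel_measurable (P \<pi>)"
      using integrable_mult_indicator[OF AP int_z] by auto
  qed
  ultimately show ?thesis
    unfolding no_change_def using diff by simp
qed

section \<open>Expected costs\<close>

text \<open>The posterior lies in the unit square only almost surely; truncating it makes the cost
  process bounded on the whole sample space.\<close>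

definition stop_cost_proc :: "real^2 \<Rightarrow> real \<Rightarrow> 'a \<Rightarrow> real" where
  "stop_cost_proc \<pi> t \<omega> =
     (1 - max 0 (min 1 (Post \<pi> t \<omega> $ 1))) * (1 - max 0 (min 1 (Post \<pi> t \<omega> $ 2)))"

lemma stop_cost_proc_measurable:
  assumes "\<pi> \<in> cbox 0 1" "0 \<le> t"
  shows "stop_cost_proc \<pi> t \<in> borel_measurable (P \<pi>)"
proof -
  have [measurable]: "(\<lambda>\<omega>. Post \<pi> t \<omega> $ i) \<in> borel_measurable (P \<pi>)" for i
    using measurable_Post[OF assms] unfolding borel_measurable_vec2 by blast
  show ?thesis unfolding stop_cost_proc_def[abs_def] by measurable
qed

lemma stop_cost_proc_bounds: "0 \<le> stop_cost_proc \<pi> t \<omega>" "stop_cost_proc \<pi> t \<omega> \<le> 1"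
proof -
  have *: "0 \<le> 1 - max 0 (min 1 (x::real))" "1 - max 0 (min 1 x) \<le> 1" for x by auto
  show "0 \<le> stop_cost_proc \<pi> t \<omega>" "stop_cost_proc \<pi> t \<omega> \<le> 1"
    unfolding stop_cost_proc_def by (intro mult_nonneg_nonneg mult_le_one *)+
qed

lemma Post_right_continuous:
  assumes "\<pi> \<in> cbox 0 1" "0 \<le> t" "\<omega> \<in> space S"
  shows "((\<lambda>s. Post \<pi> s \<omega> $ i) \<longlongrightarrow> Post \<pi> t \<omega> $ i) (at_right t)"
proof -
  have "((\<lambda>s. Post \<pi> s \<omega>) \<longlongrightarrow> Post \<pi> t \<omega>) (at t within {0..})"
    using continuous_Post[OF assms(1), of \<omega>] assms space_P[OF assms(1)]
    by (auto simp: continuous_on_def)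
  then have "((\<lambda>s. Post \<pi> s \<omega>) \<longlongrightarrow> Post \<pi> t \<omega>) (at_right t)"
    by (rule tendsto_within_subset) (use assms(2) in auto)
  then show ?thesis by (rule tendsto_vec_nth)
qed

lemma stop_cost_proc_right_continuous:
  assumes "\<pi> \<in> cbox 0 1" "0 \<le> t" "\<omega> \<in> space S"
  shows "((\<lambda>s. stop_cost_proc \<pi> s \<omega>) \<longlongrightarrow> stop_cost_proc \<pi> t \<omega>) (at_right t)"
  unfolding stop_cost_proc_def
  by (intro tendsto_intros tendsto_max tendsto_min Post_right_continuous assms)

lemma Post_bounds:
  assumes \<pi>: "\<pi> \<in> cbox 0 1" and t: "0 \<le> t"
  shows "AE \<omega> in P \<pi>. 0 \<le> Post \<pi> t \<omega> $ i \<and> Post \<pi> t \<omega> $ i \<le> 1"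
proof -
  interpret sigma_finite_subalgebra "P \<pi>" "FX (ennreal t)" by (rule sigma_finite_FX[OF \<pi>])
  have "AE \<omega> in P \<pi>. 0 \<le> real_cond_exp (P \<pi>) (FX (ennreal t)) (\<lambda>\<omega>. real (Y i t \<omega>)) \<omega>"
    by (rule real_cond_exp_ge_c[OF Y_integrable[OF \<pi> t]]) simp
  moreover have "AE \<omega> in P \<pi>. real_cond_exp (P \<pi>) (FX (ennreal t)) (\<lambda>\<omega>. real (Y i t \<omega>)) \<omega> \<le> 1"
  proof (rule real_cond_exp_le_c[OF Y_integrable[OF \<pi> t]], rule AE_I2)
    fix \<omega> assume "\<omega> \<in> space (P \<pi>)"
    then show "real (Y i t \<omega>) \<le> 1"
      using Y_values[OF t, of \<omega> i] space_P[OF \<pi>] by auto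
  qed
  ultimately show ?thesis
    using posterior_Post[OF \<pi> t, of i] by eventually_elim simp
qed

text \<open>Conditional expectations give the bounds only outside a null set depending on the time.
  Countably many rational times share one null set, and path continuity reaches the others.\<close>

lemma Post_bounds_all_times:
  assumes \<pi>: "\<pi> \<in> cbox 0 1"
  shows "AE \<omega> in P \<pi>. \<forall>t\<ge>0. \<forall>i. 0 \<le> Post \<pi> t \<omega> $ i \<and> Post \<pi> t \<omega> $ i \<le> 1"
proof -
  have "AE \<omega> in P \<pi>. \<forall>r\<in>\<rat> \<inter> {0..}. \<forall>i. 0 \<le> Post \<pi> r \<omega> $ i \<and> Post \<pi> r \<omega> $ i \<le> 1"
  proof (subst AE_ball_countable)
    show "countable (\<rat> \<inter> {0::real..})" using countable_rat by blast
    show "\<forall>r\<in>\<rat> \<inter> {0..}. AE \<omega> in P \<pi>. \<forall>i. 0 \<le> Post \<pi> r \<omega> $ i \<and> Post \<pi> r \<omega> $ i \<le> 1"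
      using Post_bounds[OF \<pi>] by (auto simp: AE_all_countable)
  qed
  then show ?thesis
  proof (rule AE_mp, intro AE_I2 impI allI)
    fix \<omega> t i
    assume \<omega>: "\<omega> \<in> space (P \<pi>)" and rat: "\<forall>r\<in>\<rat> \<inter> {0..}. \<forall>i. 0 \<le> Post \<pi> r \<omega> $ i \<and> Post \<pi> r \<omega> $ i \<le> 1"
      and t: "0 \<le> (t::real)"
    \<comment> \<open>The grid times are rational whatever \<open>t\<close> is, since
      \<open>t\<close> enters them only through a ceiling.\<close>
    let ?t = "\<lambda>n. (real_of_int \<lceil>real (Suc n) * t\<rceil> + 1) / real (Suc n)"
    have lim: "(\<lambda>n. Post \<pi> (?t n) \<omega> $ i) \<longlonglongrightarrow> Post \<pi> t \<omega> $ i"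
      using Post_right_continuous[OF \<pi> t, of \<omega> i] \<omega> space_P[OF \<pi>]
      by (intro right_continuous_grid_limit[where f="\<lambda>s. Post \<pi> s \<omega> $ i"]) simp
    have in_rat: "?t n \<in> \<rat> \<inter> {0..}" for n
    proof -
      have "0 \<le> ?t n" using grid_right_limit(2)[of t n] t by linarith
      moreover have "?t n \<in> \<rat>" by (intro Rats_divide Rats_add) auto
      ultimately show ?thesis by simp
    qed
    have "0 \<le> Post \<pi> t \<omega> $ i"
      by (rule LIMSEQ_le_const[OF lim]) (use rat in_rat in blast)
    moreover have "Post \<pi> t \<omega> $ i \<le> 1"
      by (rule LIMSEQ_le_const2[OF lim]) (use rat in_rat in blast)
    ultimately show "0 \<le> Post \<pi> t \<omega> $ i \<and> Post \<pi> t \<omega> $ i \<le> 1" ..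
  qed
qed

lemma stop_cost_proc_eq:
  assumes "\<pi> \<in> cbox 0 1"
  shows "AE \<omega> in P \<pi>. \<forall>t\<ge>0. stop_cost_proc \<pi> t \<omega> = stop_cost (Post \<pi> t \<omega>)"
  using Post_bounds_all_times[OF assms]
  by eventually_elim (simp add: stop_cost_proc_def stop_cost_def min_absorb2 max_absorb2)

lemma expected_cost_eq_stopped_cost:
  assumes \<pi>: "\<pi> \<in> cbox 0 1" and fin: "AE \<omega> in P \<pi>. \<tau> \<omega> < \<infinity>"
  shows "expected_cost (P \<pi>) c (Post \<pi>) \<tau> =
    (\<integral>\<^sup>+\<omega>. stopped_cost c (stop_cost_proc \<pi>) (\<lambda>\<omega>. enn2real (\<tau> \<omega>)) \<omega> \<partial>P \<pi>)"
  unfolding expected_cost_def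
proof (rule nn_integral_cong_AE)
  show "AE \<omega> in P \<pi>. ennreal (stop_cost (Post \<pi> (enn2real (\<tau> \<omega>)) \<omega>)) +
      (\<integral>\<^sup>+s\<in>{s. 0 \<le> s \<and> ennreal s \<le> \<tau> \<omega>}. ennreal (running_cost c (Post \<pi> s \<omega>)) \<partial>lborel) =
      stopped_cost c (stop_cost_proc \<pi>) (\<lambda>\<omega>. enn2real (\<tau> \<omega>)) \<omega>"
    using stop_cost_proc_eq[OF \<pi>] fin
  proof eventually_elim
    case (elim \<omega>)
    have "ennreal s \<le> \<tau> \<omega> \<longleftrightarrow> s \<le> enn2real (\<tau> \<omega>)" if "0 \<le> s" for s
      using elim(2) that by (cases "\<tau> \<omega>") auto
    then have "{s. 0 \<le> s \<and> ennreal s \<le> \<tau> \<omega>} = {0..enn2real (\<tau> \<omega>)}" by auto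
    moreover have "(\<integral>\<^sup>+s\<in>{0..enn2real (\<tau> \<omega>)}. ennreal (running_cost c (Post \<pi> s \<omega>)) \<partial>lborel) =
        (\<integral>\<^sup>+s\<in>{0..enn2real (\<tau> \<omega>)}. ennreal (c * (1 - stop_cost_proc \<pi> s \<omega>)) \<partial>lborel)"
      using elim(1)
      by (intro nn_integral_cong) (auto simp: running_cost_def stop_cost_def indicator_def)
    ultimately show ?case
      using elim(1) by (simp add: stopped_cost_def)
  qed
qed

section \<open>The prior-free cost of a bounded stopping time\<close>

lemma no_change_measurable_full: "0 \<le> t \<Longrightarrow> no_change t \<in> borel_measurable full"
  unfolding no_change_def[abs_def]
  by (intro borel_measurable_times borel_measurable_diff borel_measurable_const
      measurable_subsets[OF sets_G_subset_full _ real_Y_measurable_G]) simp_all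

lemma no_change_bounds:
  assumes "0 \<le> t" "\<omega> \<in> space S"
  shows "0 \<le> no_change t \<omega>" "no_change t \<omega> \<le> 1"
  using Y_values[OF assms, of 1] Y_values[OF assms, of 2] by (auto simp: no_change_def)

lemma no_change_right_continuous:
  assumes "0 \<le> t" "\<omega> \<in> space S"
  shows "((\<lambda>s. no_change s \<omega>) \<longlongrightarrow> no_change t \<omega>) (at_right t)"
  unfolding no_change_def by (intro tendsto_intros Y_right_continuous assms)

text \<open>Finiteness is required everywhere because \<open>enn2real\<close> maps infinity to 0,
  which would count a time that never comes as immediate stopping. For negative \<open>s\<close> the
  event is empty.\<close>

lemma stopping_time_level:
  assumes \<tau>: "stopping_time FX \<tau>" "\<And>\<omega>. \<tau> \<omega> < \<infinity>" and t: "0 \<le> t" "s \<le> t"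
  shows "{\<omega>\<in>space S. enn2real (\<tau> \<omega>) \<le> s} \<in> sets (FX (ennreal t))"
proof (cases "0 \<le> s")
  case True
  have "enn2real (\<tau> \<omega>) \<le> s \<longleftrightarrow> \<tau> \<omega> \<le> ennreal s" for \<omega>
    using \<tau>(2)[of \<omega>] True by (cases "\<tau> \<omega>") auto
  then have "{\<omega>\<in>space S. enn2real (\<tau> \<omega>) \<le> s} = {\<omega>\<in>space (FX (ennreal s)). \<tau> \<omega> \<le> ennreal s}" by simp
  also have "\<dots> \<in> sets (FX (ennreal s))"
    using stopping_timeD[OF \<tau>(1), of "ennreal s"] unfolding pred_def .
  also have "\<dots> \<subseteq> sets (FX (ennreal t))"
    by (rule sets_FX_mono) (use t in \<open>simp add: ennreal_leI\<close>)
  finally show ?thesis .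
next
  case False
  then have "{\<omega>\<in>space S. enn2real (\<tau> \<omega>) \<le> s} = {}"
    using enn2real_nonneg by (auto simp: not_le intro: less_le_trans)
  then show ?thesis by (simp only: sets.empty_sets)
qed

lemma stopping_time_measurable_full:
  assumes "stopping_time FX \<tau>"
  shows "(\<lambda>\<omega>. enn2real (\<tau> \<omega>)) \<in> borel_measurable full"
proof -
  have "\<tau> \<in> borel_measurable full"
    by (rule measurable_stopping_time[OF assms]) (use sets_FX_subset_full in auto)
  then show ?thesis by measurable
qed

text \<open>The integrand on the right-hand side does not depend on the prior.\<close>

lemma expected_cost_bounded:
  assumes \<pi>: "\<pi> \<in> cbox 0 1" and \<tau>: "stopping_time FX \<tau>" "\<And>\<omega>. \<tau> \<omega> \<le> ennreal T" and c: "0 \<le> c"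
  shows "expected_cost (P \<pi>) c (Post \<pi>) \<tau> =
    (\<integral>\<^sup>+\<omega>. stopped_cost c no_change (\<lambda>\<omega>. enn2real (\<tau> \<omega>)) \<omega> \<partial>P \<pi>)"
proof -
  have fin: "\<tau> \<omega> < \<infinity>" for \<omega>
    using \<tau>(2)[of \<omega>] by (simp add: le_less_trans[OF _ ennreal_less_top])
  \<comment> \<open>\<open>T\<close> may be negative here; \<open>ennreal T\<close> is then 0, and 0
    is the real bound.\<close>
  have le_T: "enn2real (\<tau> \<omega>) \<le> max 0 T" for \<omega>
    using enn2real_mono[OF \<tau>(2)[of \<omega>]] by (auto simp: enn2real_ennreal max_def ennreal_neg split: if_splits)
  have full_P: "f \<in> borel_measurable (P \<pi>)" if "f \<in> borel_measurable full" for f :: "'a \<Rightarrow> real"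
    by (rule measurable_from_subalg[OF subalgebra_full[OF \<pi>] that])
  have "(\<integral>\<^sup>+\<omega>. stopped_cost c (stop_cost_proc \<pi>) (\<lambda>\<omega>. enn2real (\<tau> \<omega>)) \<omega> \<partial>P \<pi>) =
      (\<integral>\<^sup>+\<omega>. stopped_cost c no_change (\<lambda>\<omega>. enn2real (\<tau> \<omega>)) \<omega> \<partial>P \<pi>)"
  proof (rule stopped_cost_cong[where F="\<lambda>t. FX (ennreal t)" and T="max 0 T"])
    show "(LINT \<omega>:A|P \<pi>. stop_cost_proc \<pi> t \<omega>) = (LINT \<omega>:A|P \<pi>. no_change t \<omega>)"
      if t: "0 \<le> t" and A: "A \<in> sets (FX (ennreal t))" for t A
    proof -
      have AP: "A \<in> sets (P \<pi>)" using A subalgebra_FX[OF \<pi>] unfolding subalgebra_def by blast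
      have "(\<lambda>\<omega>. Post \<pi> t \<omega> $ i) \<in> borel_measurable (P \<pi>)" for i
        using measurable_Post[OF \<pi> t] unfolding borel_measurable_vec2 by blast
      then have "(LINT \<omega>:A|P \<pi>. stop_cost_proc \<pi> t \<omega>) = (LINT \<omega>:A|P \<pi>. stop_cost (Post \<pi> t \<omega>))"
        unfolding set_lebesgue_integral_def
        using stop_cost_proc_eq[OF \<pi>] t AP stop_cost_proc_measurable[OF \<pi> t]
        by (intro integral_cong_AE) (auto simp: stop_cost_def)
      then show ?thesis using stop_cost_Post_set_integral[OF \<pi> t A] by simp
    qed
  qed (use \<pi> c prob_space_P subalgebra_FX stop_cost_proc_measurable stop_cost_proc_bounds
      stop_cost_proc_right_continuous no_change_bounds no_change_right_continuous
      no_change_measurable_full[THEN full_P] stopping_time_level[OF \<tau>(1) fin]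
      stopping_time_measurable_full[OF \<tau>(1), THEN full_P] le_T in \<open>simp_all add: space_P\<close>)
  then show ?thesis
    unfolding expected_cost_eq_stopped_cost[OF \<pi> AE_I2[OF fin]] .
qed

text \<open>Under all three priors the cost is the integral of one and the same
  \<open>full\<close>-measurable function, so it inherits the mixture relation of the
  measures.\<close>

lemma expected_cost_mixture:
  assumes \<pi>: "\<pi> \<in> cbox 0 1" "\<pi>0 \<in> cbox 0 1" "\<pi>1 \<in> cbox 0 1" and q: "0 \<le> q" "q \<le> 1"
    and i: "\<pi> $ i = (1 - q) * \<pi>0 $ i + q * \<pi>1 $ i"
    and other: "\<And>j. j \<noteq> i \<Longrightarrow> \<pi> $ j = \<pi>0 $ j \<and> \<pi> $ j = \<pi>1 $ j"
    and \<tau>: "stopping_time FX \<tau>" "\<And>\<omega>. \<tau> \<omega> \<le> ennreal T" and c: "0 \<le> c"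
  shows "expected_cost (P \<pi>) c (Post \<pi>) \<tau> =
    ennreal (1 - q) * expected_cost (P \<pi>0) c (Post \<pi>0) \<tau> + ennreal q * expected_cost (P \<pi>1) c (Post \<pi>1) \<tau>"
proof -
  have "stopped_cost c no_change (\<lambda>\<omega>. enn2real (\<tau> \<omega>)) \<in> borel_measurable full"
    by (rule stopped_cost_measurable[OF no_change_measurable_full no_change_right_continuous
          stopping_time_measurable_full[OF \<tau>(1)]]) auto
  then show ?thesis
    unfolding expected_cost_bounded[OF \<pi>(1) \<tau> c] expected_cost_bounded[OF \<pi>(2) \<tau> c] expected_cost_bounded[OF \<pi>(3) \<tau> c]
    by (intro nn_integral_mixture[of _ full])
      (use \<pi> q prob_space_P subalgebra_full prob_full_mixture[OF \<pi> i other] in auto)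
qed

section \<open>From stopping times to biaffine polynomials\<close>

lemma expected_cost_finite:
  assumes \<pi>: "\<pi> \<in> cbox 0 1" and \<tau>: "stopping_time FX \<tau>" "\<And>\<omega>. \<tau> \<omega> \<le> ennreal T" and c: "0 \<le> c" and T: "0 \<le> T"
  shows "expected_cost (P \<pi>) c (Post \<pi>) \<tau> < \<infinity>"
proof -
  interpret prob_space "P \<pi>" by (rule prob_space_P[OF \<pi>])
  have le_T: "enn2real (\<tau> \<omega>) \<le> T" for \<omega>
    using enn2real_mono[OF \<tau>(2)[of \<omega>]] T by simp
  have "stopped_cost c no_change (\<lambda>\<omega>. enn2real (\<tau> \<omega>)) \<omega> \<le> ennreal (1 + c * T)" if \<omega>: "\<omega> \<in> space S" for \<omega>
  proof -
    have "(\<integral>\<^sup>+s\<in>{0..enn2real (\<tau> \<omega>)}. ennreal (c * (1 - no_change s \<omega>)) \<partial>lborel) \<le>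
        (\<integral>\<^sup>+s. ennreal c * indicator {0..T} s \<partial>lborel)"
      using le_T[of \<omega>] no_change_bounds[OF _ \<omega>] c
      by (intro nn_integral_mono) (auto simp: indicator_def intro!: ennreal_leI mult_left_le)
    also have "\<dots> = ennreal (c * T)"
      using T c by (simp add: nn_integral_cmult ennreal_mult)
    finally have "stopped_cost c no_change (\<lambda>\<omega>. enn2real (\<tau> \<omega>)) \<omega> \<le> ennreal 1 + ennreal (c * T)"
      unfolding stopped_cost_def using no_change_bounds[OF enn2real_nonneg \<omega>]
      by (intro add_mono ennreal_leI) auto
    then show ?thesis using c T by (simp add: ennreal_plus)
  qed
  then have "(\<integral>\<^sup>+\<omega>. stopped_cost c no_change (\<lambda>\<omega>. enn2real (\<tau> \<omega>)) \<omega> \<partial>P \<pi>) \<le> (\<integral>\<^sup>+\<omega>. ennreal (1 + c * T) \<partial>P \<pi>)"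
    by (intro nn_integral_mono) (simp add: space_P[OF \<pi>])
  also have "\<dots> < \<infinity>" by (simp add: emeasure_space_1)
  finally show ?thesis unfolding expected_cost_bounded[OF \<pi> \<tau> c] .
qed

text \<open>Stopping earlier lowers the running cost, and the terminal cost rises by at most 1, only
  when the truncation is active. The probability of that event tends to 0, so a strict bound
  \<open>K\<close> survives. The truncated time is bounded everywhere and therefore admissible under
  every prior.\<close>

lemma expected_cost_truncate:
  assumes \<pi>: "\<pi> \<in> cbox 0 1" and c: "0 \<le> c"
    and \<tau>: "stopping_time FX \<tau>" "AE \<omega> in P \<pi>. \<tau> \<omega> < \<infinity>"
    and less: "expected_cost (P \<pi>) c (Post \<pi>) \<tau> < K"
  obtains T where "0 \<le> T" "expected_cost (P \<pi>) c (Post \<pi>) (\<lambda>\<omega>. min (\<tau> \<omega>) (ennreal T)) < K"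
proof -
  interpret prob_space "P \<pi>" by (rule prob_space_P[OF \<pi>])
  let ?\<sigma> = "\<lambda>\<omega>. enn2real (\<tau> \<omega>)" and ?u = "stop_cost_proc \<pi>"
  \<comment> \<open>Written with the real-valued \<open>?\<sigma>\<close>, these events decrease to
    the empty set. Outcomes with infinite \<open>\<tau>\<close>, which \<open>enn2real\<close> sends
    to 0, form a null set.\<close>
  let ?late = "\<lambda>n::nat. {\<omega>\<in>space (P \<pi>). real n < ?\<sigma> \<omega>}"
  have \<sigma>: "?\<sigma> \<in> borel_measurable (P \<pi>)"
    by (rule measurable_from_subalg[OF subalgebra_full[OF \<pi>] stopping_time_measurable_full[OF \<tau>(1)]])
  then have late: "?late n \<in> sets (P \<pi>)" for n by measurable
  have cost: "stopped_cost c ?u ?\<sigma> \<in> borel_measurable (P \<pi>)"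
    by (rule stopped_cost_measurable[OF stop_cost_proc_measurable[OF \<pi>] stop_cost_proc_right_continuous[OF \<pi>] \<sigma>])
      (auto simp: space_P[OF \<pi>])
  have "(\<lambda>n. prob (?late n)) \<longlonglongrightarrow> prob (\<Inter>n. ?late n)"
    using late by (intro finite_Lim_measure_decseq) (auto simp: decseq_def)
  moreover have "(\<Inter>n. ?late n) = {}"
    using reals_Archimedean2 by (fastforce simp: not_less[symmetric] dest: less_imp_le)
  ultimately have "(\<lambda>n. ennreal (prob (?late n))) \<longlonglongrightarrow> ennreal 0"
    by (intro tendsto_ennrealI) simp
  then have "(\<lambda>n. expected_cost (P \<pi>) c (Post \<pi>) \<tau> + ennreal (prob (?late n)))
      \<longlonglongrightarrow> expected_cost (P \<pi>) c (Post \<pi>) \<tau> + ennreal 0"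
    by (intro tendsto_add tendsto_const)
  then have "\<forall>\<^sub>F n in sequentially. expected_cost (P \<pi>) c (Post \<pi>) \<tau> + ennreal (prob (?late n)) < K"
    using less by (intro order_tendstoD(2)) simp_all
  then obtain n where n: "expected_cost (P \<pi>) c (Post \<pi>) \<tau> + ennreal (prob (?late n)) < K"
    by (auto simp: eventually_sequentially)
  let ?\<tau>n = "\<lambda>\<omega>. min (\<tau> \<omega>) (ennreal (real n))"
  have "expected_cost (P \<pi>) c (Post \<pi>) ?\<tau>n =
      (\<integral>\<^sup>+\<omega>. stopped_cost c ?u (\<lambda>\<omega>. enn2real (?\<tau>n \<omega>)) \<omega> \<partial>P \<pi>)"
    by (rule expected_cost_eq_stopped_cost[OF \<pi>]) (auto simp: min_less_iff_disj)
  also have "\<dots> \<le> (\<integral>\<^sup>+\<omega>. stopped_cost c ?u ?\<sigma> \<omega> + indicator (?late n) \<omega> \<partial>P \<pi>)"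
  proof (rule nn_integral_mono_AE)
    show "AE \<omega> in P \<pi>. stopped_cost c ?u (\<lambda>\<omega>. enn2real (?\<tau>n \<omega>)) \<omega> \<le> stopped_cost c ?u ?\<sigma> \<omega> + indicator (?late n) \<omega>"
      using \<tau>(2) AE_space
    proof eventually_elim
      case (elim \<omega>)
      have min: "enn2real (?\<tau>n \<omega>) = min (?\<sigma> \<omega>) (real n)"
        using elim(1) by (cases "\<tau> \<omega>") (auto simp: min_def)
      have "ennreal (?u (min (?\<sigma> \<omega>) (real n)) \<omega>) \<le> ennreal (?u (?\<sigma> \<omega>) \<omega>) + indicator (?late n) \<omega>"
      proof (cases "real n < ?\<sigma> \<omega>")
        case True
        have "ennreal (?u (min (?\<sigma> \<omega>) (real n)) \<omega>) \<le> 1"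
          using stop_cost_proc_bounds by simp
        then show ?thesis using True elim(2) by (simp add: add_increasing)
      qed (simp add: min_def)
      moreover have "(\<integral>\<^sup>+s\<in>{0..min (?\<sigma> \<omega>) (real n)}. ennreal (c * (1 - ?u s \<omega>)) \<partial>lborel) \<le>
          (\<integral>\<^sup>+s\<in>{0..?\<sigma> \<omega>}. ennreal (c * (1 - ?u s \<omega>)) \<partial>lborel)"
        by (intro nn_integral_mono) (auto simp: indicator_def)
      ultimately have "stopped_cost c ?u (\<lambda>\<omega>. enn2real (?\<tau>n \<omega>)) \<omega> \<le>
          (ennreal (?u (?\<sigma> \<omega>) \<omega>) + indicator (?late n) \<omega>) +
          (\<integral>\<^sup>+s\<in>{0..?\<sigma> \<omega>}. ennreal (c * (1 - ?u s \<omega>)) \<partial>lborel)"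
        unfolding stopped_cost_def min by (rule add_mono)
      then show ?case
        unfolding stopped_cost_def by (simp only: ac_simps)
    qed
  qed
  also have "\<dots> = expected_cost (P \<pi>) c (Post \<pi>) \<tau> + ennreal (prob (?late n))"
    unfolding expected_cost_eq_stopped_cost[OF \<pi> \<tau>(2)]
    using cost late by (simp add: nn_integral_add emeasure_eq_measure)
  finally show ?thesis using n by (intro that[of "real n"]) auto
qed

text \<open>Affine interpolation in one coordinate and then in the other determines the cost by its
  values at the four corners. Nonnegativity of the polynomial is recorded as well, because
  \<open>ennreal\<close> maps all negative numbers to 0 and the equation alone would not pin down
  the real value.\<close>

lemma expected_cost_biaffine:
  assumes \<tau>: "stopping_time FX \<tau>" "\<And>\<omega>. \<tau> \<omega> \<le> ennreal T" and c: "0 \<le> c" and T: "0 \<le> T"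
  obtains a\<^sub>0 a\<^sub>1 a\<^sub>2 a\<^sub>3 where "\<And>\<pi>. \<pi> \<in> cbox 0 1 \<Longrightarrow>
      0 \<le> a\<^sub>0 + a\<^sub>1 * \<pi> $ 1 + a\<^sub>2 * \<pi> $ 2 + a\<^sub>3 * (\<pi> $ 1 * \<pi> $ 2) \<and>
      expected_cost (P \<pi>) c (Post \<pi>) \<tau> =
        ennreal (a\<^sub>0 + a\<^sub>1 * \<pi> $ 1 + a\<^sub>2 * \<pi> $ 2 + a\<^sub>3 * (\<pi> $ 1 * \<pi> $ 2))"
proof -
  define v :: "real \<Rightarrow> real \<Rightarrow> real^2" where "v x y = vector [x, y]" for x y
  have v [simp]: "v x y $ 1 = x" "v x y $ 2 = y" for x y
    by (simp_all add: v_def)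
  have v_eta: "v (p $ 1) (p $ 2) = p" for p
    by (simp add: vec_eq_iff forall_2)
  have box: "v x y \<in> cbox 0 1" if "0 \<le> x" "x \<le> 1" "0 \<le> y" "y \<le> 1" for x y
    using that by (simp add: mem_box_cart forall_2)
  let ?E = "\<lambda>\<pi>. expected_cost (P \<pi>) c (Post \<pi>) \<tau>"
  define e where "e x y = enn2real (?E (v x y))" for x y
  have E: "?E (v x y) = ennreal (e x y)" if "0 \<le> x" "x \<le> 1" "0 \<le> y" "y \<le> 1" for x y
    unfolding e_def using expected_cost_finite[OF box[OF that] \<tau> c T] by simp
  have e_nonneg: "0 \<le> e x y" for x y by (simp add: e_def)
  have real_mixture: "u = (1 - q) * u0 + q * u1"
    if "ennreal u = ennreal (1 - q) * ennreal u0 + ennreal q * ennreal u1"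
      "0 \<le> u" "0 \<le> u0" "0 \<le> u1" "0 \<le> q" "q \<le> 1" for u u0 u1 q
  proof -
    have "ennreal u = ennreal ((1 - q) * u0 + q * u1)"
      using that by (simp add: ennreal_mult ennreal_plus)
    then show ?thesis
      by (rule ennreal_inj[THEN iffD1, rotated 2]) (use that in auto)
  qed
  have ex: "e x y = (1 - x) * e 0 y + x * e 1 y" if "0 \<le> x" "x \<le> 1" "0 \<le> y" "y \<le> 1" for x y
  proof (rule real_mixture)
    have "?E (v x y) = ennreal (1 - x) * ?E (v 0 y) + ennreal x * ?E (v 1 y)"
    proof (rule expected_cost_mixture[where i=1, OF box box box])
      show "v x y $ j = v 0 y $ j \<and> v x y $ j = v 1 y $ j" if "j \<noteq> 1" for j
        using that exhaust_2[of j] by auto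
    qed (use that \<tau> c in auto)
    then show "ennreal (e x y) = ennreal (1 - x) * ennreal (e 0 y) + ennreal x * ennreal (e 1 y)"
      using that by (simp add: E)
  qed (use that e_nonneg in auto)
  have ey: "e x y = (1 - y) * e x 0 + y * e x 1" if "0 \<le> x" "x \<le> 1" "0 \<le> y" "y \<le> 1" for x y
  proof (rule real_mixture)
    have "?E (v x y) = ennreal (1 - y) * ?E (v x 0) + ennreal y * ?E (v x 1)"
    proof (rule expected_cost_mixture[where i=2, OF box box box])
      show "v x y $ j = v x 0 $ j \<and> v x y $ j = v x 1 $ j" if "j \<noteq> 2" for j
        using that exhaust_2[of j] by auto
    qed (use that \<tau> c in auto)
    then show "ennreal (e x y) = ennreal (1 - y) * ennreal (e x 0) + ennreal y * ennreal (e x 1)"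
      using that by (simp add: E)
  qed (use that e_nonneg in auto)
  \<comment> \<open>The bilinear interpolant of the four corner values, expanded in
    monomials.\<close>
  let ?p = "\<lambda>x y. e 0 0 + (e 1 0 - e 0 0) * x + (e 0 1 - e 0 0) * y + (e 1 1 - e 1 0 - e 0 1 + e 0 0) * (x * y)"
  have e_eq: "e x y = ?p x y" if xy: "0 \<le> x" "x \<le> 1" "0 \<le> y" "y \<le> 1" for x y
  proof -
    have "e 0 y = (1 - y) * e 0 0 + y * e 0 1" "e 1 y = (1 - y) * e 1 0 + y * e 1 1"
      by (rule ey; use xy in simp)+
    then show ?thesis unfolding ex[OF xy] by (simp only:) (simp add: algebra_simps)
  qed
  show ?thesis
  proof (rule that)
    fix \<pi> :: "real^2" assume "\<pi> \<in> cbox 0 1"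
    then have xy: "0 \<le> \<pi> $ 1" "\<pi> $ 1 \<le> 1" "0 \<le> \<pi> $ 2" "\<pi> $ 2 \<le> 1"
      by (simp_all add: mem_box_cart)
    show "0 \<le> ?p (\<pi> $ 1) (\<pi> $ 2) \<and> ?E \<pi> = ennreal (?p (\<pi> $ 1) (\<pi> $ 2))"
      using e_nonneg[of "\<pi> $ 1" "\<pi> $ 2"] E[OF xy] unfolding e_eq[OF xy] v_eta by simp
  qed
qed

text \<open>The coefficients belong to a single bounded stopping time that beats stopping at once
  under \<open>\<pi>\<close>. Wherever the polynomial is negative, that same time beats stopping at
  once under the prior \<open>p\<close> too.\<close>

lemma continuation_witness:
  assumes \<pi>: "\<pi> \<in> cbox 0 1" and c: "0 \<le> c"
    and less: "optimal_value (P \<pi>) FX c (Post \<pi>) < ennreal (stop_cost \<pi>)"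
  obtains a\<^sub>0 a\<^sub>1 a\<^sub>2 a\<^sub>3 where
    "a\<^sub>0 + a\<^sub>1 * \<pi> $ 1 + a\<^sub>2 * \<pi> $ 2 + a\<^sub>3 * (\<pi> $ 1 * \<pi> $ 2) < 0"
    "\<And>y. 0 \<le> y \<Longrightarrow> y \<le> 1 \<Longrightarrow> 0 \<le> a\<^sub>0 + a\<^sub>1 * 1 + a\<^sub>2 * y + a\<^sub>3 * (1 * y)"
    "\<And>x. 0 \<le> x \<Longrightarrow> x \<le> 1 \<Longrightarrow> 0 \<le> a\<^sub>0 + a\<^sub>1 * x + a\<^sub>2 * 1 + a\<^sub>3 * (x * 1)"
    "\<And>p. p \<in> cbox 0 1 \<Longrightarrow> a\<^sub>0 + a\<^sub>1 * p $ 1 + a\<^sub>2 * p $ 2 + a\<^sub>3 * (p $ 1 * p $ 2) < 0 \<Longrightarrow>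
      optimal_value (P p) FX c (Post p) < ennreal (stop_cost p)"
proof -
  obtain \<tau> where \<tau>: "stopping_time FX \<tau>" "AE \<omega> in P \<pi>. \<tau> \<omega> < \<infinity>"
    "expected_cost (P \<pi>) c (Post \<pi>) \<tau> < ennreal (stop_cost \<pi>)"
    using less unfolding optimal_value_def INF_less_iff by blast
  obtain T where T: "0 \<le> T"
    and less_T: "expected_cost (P \<pi>) c (Post \<pi>) (\<lambda>\<omega>. min (\<tau> \<omega>) (ennreal T)) < ennreal (stop_cost \<pi>)"
    by (rule expected_cost_truncate[OF \<pi> c \<tau>])
  let ?\<tau> = "\<lambda>\<omega>. min (\<tau> \<omega>) (ennreal T)"
  have stop: "stopping_time FX ?\<tau>"
    by (intro stopping_time_min \<tau>(1) stopping_time_const)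
  have le_T: "?\<tau> \<omega> \<le> ennreal T" for \<omega> by simp
  obtain a\<^sub>0 a\<^sub>1 a\<^sub>2 a\<^sub>3 where E: "\<And>p. p \<in> cbox 0 1 \<Longrightarrow>
      0 \<le> a\<^sub>0 + a\<^sub>1 * p $ 1 + a\<^sub>2 * p $ 2 + a\<^sub>3 * (p $ 1 * p $ 2) \<and>
      expected_cost (P p) c (Post p) ?\<tau> = ennreal (a\<^sub>0 + a\<^sub>1 * p $ 1 + a\<^sub>2 * p $ 2 + a\<^sub>3 * (p $ 1 * p $ 2))"
    by (rule expected_cost_biaffine[OF stop le_T c T]) (rule that, blast)
  \<comment> \<open>The shifts of the coefficients come from subtracting
    \<open>(1 - x) * (1 - y)\<close>, that is \<open>1 - x - y + x * y\<close>.\<close>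
  let ?D = "\<lambda>x y. (a\<^sub>0 - 1) + (a\<^sub>1 + 1) * x + (a\<^sub>2 + 1) * y + (a\<^sub>3 - 1) * (x * y)"
  have D: "?D (p $ 1) (p $ 2) = (a\<^sub>0 + a\<^sub>1 * p $ 1 + a\<^sub>2 * p $ 2 + a\<^sub>3 * (p $ 1 * p $ 2)) - stop_cost p" for p
    by (simp add: stop_cost_def algebra_simps)
  have less_iff: "?D (p $ 1) (p $ 2) < 0 \<longleftrightarrow> expected_cost (P p) c (Post p) ?\<tau> < ennreal (stop_cost p)"
    if "p \<in> cbox 0 1" for p
    unfolding D using E[OF that] by (simp add: ennreal_less_iff)
  \<comment> \<open>Adding back the cost of stopping at once recovers the nonnegative expected cost.
    On the edges \<open>x = 1\<close> and \<open>y = 1\<close> the added term vanishes, which gives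
    the two edge conditions.\<close>
  have nonneg: "0 \<le> ?D x y + (1 - x) * (1 - y)" if "0 \<le> x" "x \<le> 1" "0 \<le> y" "y \<le> 1" for x y
    using E[of "vector [x, y]"] that by (simp add: mem_box_cart forall_2 algebra_simps)
  show ?thesis
  proof (rule that)
    show "?D (\<pi> $ 1) (\<pi> $ 2) < 0" using less_iff[OF \<pi>] less_T by simp
    show "0 \<le> ?D 1 y" if "0 \<le> y" "y \<le> 1" for y using nonneg[of 1 y] that by simp
    show "0 \<le> ?D x 1" if "0 \<le> x" "x \<le> 1" for x using nonneg[of x 1] that by simp
    show "optimal_value (P p) FX c (Post p) < ennreal (stop_cost p)"
      if p: "p \<in> cbox 0 1" "?D (p $ 1) (p $ 2) < 0" for p
    proof -
      have "optimal_value (P p) FX c (Post p) \<le> expected_cost (P p) c (Post p) ?\<tau>"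
        unfolding optimal_value_def
        by (rule INF_lower) (use stop in \<open>auto simp: min_less_iff_disj\<close>)
      also have "\<dots> < ennreal (stop_cost p)" using less_iff[OF p(1)] p(2) by blast
      finally show ?thesis .
    qed
  qed
qed

end

section \<open>The boundary of the continuation region\<close>

theorem proposition5p1:
  fixes S :: "'a measure"
    and P :: "real^2 \<Rightarrow> 'a measure"
    and \<mu> l :: "real^2"
    and c :: real
    and Y :: "2 \<Rightarrow> real \<Rightarrow> 'a \<Rightarrow> nat"
    and W :: "2 \<Rightarrow> real \<Rightarrow> 'a \<Rightarrow> real"
    and Post :: "real^2 \<Rightarrow> real \<Rightarrow> 'a \<Rightarrow> real^2"
    and V :: "real^2 \<Rightarrow> ennreal"
    and C :: "(real^2) set"
  assumes mu_pos: "\<And>i. 0 < \<mu> $ i"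
    and l_pos: "\<And>i. 0 < l $ i"
    and c_pos: "0 < c"
    and model: "quickest_detection S P \<mu> l Y W Post"
    and V: "\<And>\<pi>. \<pi> \<in> cbox 0 1 \<Longrightarrow>
          V \<pi> = optimal_value (P \<pi>) (natural_filtration (space S) borel (observation \<mu> Y W)) c (Post \<pi>)"
    and C: "C = {\<pi> \<in> cbox 0 1. V \<pi> < ennreal (stop_cost \<pi>)}"
  shows "\<exists>b :: real \<Rightarrow> real.
           b ` {0..1} \<subseteq> {0..1} \<and>
           antimono_on {0..1} b \<and>
           lower_semicontinuous_on {0..1} b \<and>
           C = {\<pi> \<in> cbox 0 1. \<pi> $ 2 < b (\<pi> $ 1)}"
proof (rule down_set_is_subgraph)
  interpret quickest_detection S P \<mu> l Y W Post by (rule model)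
  show "C \<subseteq> cbox 0 1" unfolding C by blast
  have C_iff: "p \<in> C \<longleftrightarrow> optimal_value (P p) FX c (Post p) < ennreal (stop_cost p)" if "p \<in> cbox 0 1" for p
    using that V[OF that] by (simp add: C)
  fix p assume "p \<in> C"
  then have p: "p \<in> cbox 0 1" "optimal_value (P p) FX c (Post p) < ennreal (stop_cost p)"
    using C_iff C by auto
  then have p_bounds: "0 \<le> p $ i" "p $ i \<le> 1" for i
    by (simp_all add: mem_box_cart)
  obtain a\<^sub>0 a\<^sub>1 a\<^sub>2 a\<^sub>3 where neg: "a\<^sub>0 + a\<^sub>1 * p $ 1 + a\<^sub>2 * p $ 2 + a\<^sub>3 * (p $ 1 * p $ 2) < 0"
    and edges: "\<And>y. 0 \<le> y \<Longrightarrow> y \<le> 1 \<Longrightarrow> 0 \<le> a\<^sub>0 + a\<^sub>1 * 1 + a\<^sub>2 * y + a\<^sub>3 * (1 * y)"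
      "\<And>x. 0 \<le> x \<Longrightarrow> x \<le> 1 \<Longrightarrow> 0 \<le> a\<^sub>0 + a\<^sub>1 * x + a\<^sub>2 * 1 + a\<^sub>3 * (x * 1)"
    and imp: "\<And>q. q \<in> cbox 0 1 \<Longrightarrow> a\<^sub>0 + a\<^sub>1 * q $ 1 + a\<^sub>2 * q $ 2 + a\<^sub>3 * (q $ 1 * q $ 2) < 0 \<Longrightarrow>
      optimal_value (P q) FX c (Post q) < ennreal (stop_cost q)"
    using continuation_witness[OF p(1) less_imp_le[OF c_pos] p(2)] by metis
  show "q \<in> C" if q: "q \<in> cbox 0 1" "\<And>i. q $ i \<le> p $ i" for q
  proof -
    have "a\<^sub>0 + a\<^sub>1 * q $ 1 + a\<^sub>2 * q $ 2 + a\<^sub>3 * (q $ 1 * q $ 2) < 0"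
      by (rule biaffine_negative_down[OF edges neg]) (use q p_bounds in \<open>auto simp: mem_box_cart\<close>)
    then show ?thesis using imp[OF q(1)] C_iff[OF q(1)] by blast
  qed
  \<comment> \<open>A point of \<open>C\<close> stays off both edges, where the polynomial is
    nonnegative, so there is room to move strictly up and to the right.\<close>
  have "p $ 1 \<noteq> 1" using edges(1)[of "p $ 2"] neg p_bounds[of 2] by auto
  moreover have "p $ 2 \<noteq> 1" using edges(2)[of "p $ 1"] neg p_bounds[of 1] by auto
  ultimately have "p $ 1 < 1" "p $ 2 < 1" using p_bounds[of 1] p_bounds[of 2] by auto
  then obtain x y where xy: "p $ 1 < x" "x < 1" "p $ 2 < y" "y < 1" "a\<^sub>0 + a\<^sub>1 * x + a\<^sub>2 * y + a\<^sub>3 * (x * y) < 0"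
    by (rule biaffine_negative_up[OF neg])
  let ?q = "vector [x, y] :: real^2"
  have q: "?q \<in> cbox 0 1"
    using xy p_bounds[of 1] p_bounds[of 2] by (auto simp: mem_box_cart forall_2)
  show "\<exists>q\<in>C. \<forall>i. p $ i < q $ i"
  proof (intro bexI)
    show "\<forall>i. p $ i < ?q $ i" using xy by (simp add: forall_2)
    show "?q \<in> C" using imp[OF q] xy(5) C_iff[OF q] by simp
  qed
qed

end
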